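(* Assume that $\Omega\subset\mathbb{H}$ is an open set such that $\partial\Omega$ is $3$-regular. Then $$\frac{\mathrm{v}_{\Omega}(B(p,r))(s)}{r^{4}} \lesssim \beta_{\partial\Omega,1}(B(p,24r)), \qquad p\in\partial\Omega,\ 0<s\leq r,$$ where the implicit constant depends only on the $3$-regularity constant of $\partial\Omega$.
   Context: The first Heisenberg group is $\mathbb{H} = (\mathbb{R}^{3},\cdot)$ with group law $(x,y,t)\cdot(x',y',t') = (x+x',y+y',t+t'+\tfrac12(xy'-x'y))$, equipped with the metric $d(p,q) = \|q^{-1}\cdot p\|$, $\|(x,y,t)\| = \max\{|(x,y)|, 2\sqrt{|t|}\}$. Balls $B(p,r)=\{q: d(p,q)<r\}$, distances, diameters and Hausdorff measures are with respect to $d$; $dp$ denotes Lebesgue measure on $\mathbb{R}^3$. A closed set $E \subset \mathbb{H}$ is $3$-regular if there is a constant $A\geq 1$ with $A^{-1}r^3 \leq \mathcal{H}^3(E\cap B(q,r)) \leq A r^3$ for all $q\in E$ and $0<r\leq\operatorname{diam}E$, $r<\infty$. For measurable $\Omega,U\subset\mathbb{H}$ and $s>0$, the vertical perimeter of $\Omega$ relative to $U$ at scale $s$ is $\mathrm{v}_{\Omega}(U)(s) = \int_{U}|\chi_\Omega(p)-\chi_\Omega(p\cdot(0,0,s^2))|\,dp$. A vertical subgroup $\mathbb{W}$ is a $2$-dimensional linear subspace of $\mathbb{R}^3$ containing the $t$-axis. For $E\subset\mathbb{H}$ with locally finite $\mathcal{H}^3$ measure and $q \in E$, $$\beta_{E,1}(B(q,r))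 := \inf_{\mathbb{W},z}\frac{1}{r^3}\int_{B(q,r)\cap E}\frac{\operatorname{dist}(x,z\cdot\mathbb{W})}{r}\,d\mathcal{H}^3(x),$$ the infimum being over all vertical subgroups $\mathbb{W}$ and all $z\in\mathbb{H}$. *)

theory Defs
  imports "HOL-Analysis.Analysis"
begin

section \<open>The first Heisenberg group\<close>

text \<open>
  The library's product type carries the Euclidean topology, linear structure and Lebesgue
  measure of three-dimensional space. The metric \<open>heis_dist\<close> below induces the same topology
  (lemma \<open>open_iff_heis_ball\<close>), so \<^const>\<open>open\<close>, \<^const>\<open>closed\<close> and \<^const>\<open>frontier\<close> are
  used for subsets of the Heisenberg group.
\<close>

type_synonym heis = "real \<times> real \<times> real"

fun heis_mult :: "heis \<Rightarrow> heis \<Rightarrow> heis" (infixl \<open>\<odot>\<close> 70) where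
  "(x, y, t) \<odot> (x', y', t') = (x + x', y + y', t + t' + (x * y' - x' * y) / 2)"

fun heis_inv :: "heis \<Rightarrow> heis" where
  "heis_inv (x, y, t) = (- x, - y, - t)"

fun heis_norm :: "heis \<Rightarrow> real" where
  "heis_norm (x, y, t) = max (norm (x, y)) (2 * sqrt \<bar>t\<bar>)"

definition heis_dist :: "heis \<Rightarrow> heis \<Rightarrow> real" where
  "heis_dist p q = heis_norm (heis_inv q \<odot> p)"

definition heis_ball :: "heis \<Rightarrow> real \<Rightarrow> heis set" where
  "heis_ball p r = {q. heis_dist p q < r}"

definition heis_diam :: "heis set \<Rightarrow> ennreal" where
  "heis_diam A = (SUP p\<in>A. SUP q\<in>A. ennreal (heis_dist p q))"

definition heis_setdist :: "heis \<Rightarrow> heis set \<Rightarrow> ennreal" where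
  "heis_setdist p A = (INF q\<in>A. ennreal (heis_dist p q))"

lemma heis_group:
  "(p \<odot> q) \<odot> r = p \<odot> (q \<odot> r)" "0 \<odot> p = p" "p \<odot> 0 = p"
  "heis_inv p \<odot> p = 0" "p \<odot> heis_inv p = 0"
  by (cases p; cases q; cases r; auto simp: zero_prod_def field_simps)+

lemma heis_norm_mult: "heis_norm (p \<odot> q) \<le> heis_norm p + heis_norm q"
proof -
  obtain x y t x' y' t' where pq: "p = (x, y, t)" "q = (x', y', t')"
    by (metis prod_cases3)
  define a b where "a = heis_norm p" and "b = heis_norm q"
  have a: "norm (x, y) \<le> a" "2 * sqrt \<bar>t\<bar> \<le> a" and b: "norm (x', y') \<le> b" "2 * sqrt \<bar>t'\<bar> \<le> b"
    by (auto simp: a_def b_def pq)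
  have nn: "0 \<le> a" "0 \<le> b"
    using a(1) b(1) norm_ge_zero order_trans by blast+
  have ta: "4 * \<bar>t\<bar> \<le> a\<^sup>2"
    using power_mono[OF a(2), of 2] by (simp add: power_mult_distrib)
  have tb: "4 * \<bar>t'\<bar> \<le> b\<^sup>2"
    using power_mono[OF b(2), of 2] by (simp add: power_mult_distrib)
  have "\<bar>(x, y) \<bullet> (y', - x')\<bar> \<le> norm (x, y) * norm (y', - x')"
    by (rule Cauchy_Schwarz_ineq2)
  also have "norm (y', - x') = norm (x', y')"
    by (simp add: norm_Pair add.commute)
  also have "norm (x, y) * norm (x', y') \<le> a * b"
    using a(1) b(1) nn by (intro mult_mono) auto
  finally have w: "\<bar>x * y' - x' * y\<bar> \<le> a * b"
    by (simp add: algebra_simps)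
  have "4 * \<bar>t + t' + (x * y' - x' * y) / 2\<bar> \<le> (a + b)\<^sup>2"
  proof -
    have "4 * \<bar>u + v + k / 2\<bar> \<le> P + Q + 2 * R"
      if "4 * \<bar>u\<bar> \<le> P" "4 * \<bar>v\<bar> \<le> Q" "\<bar>k\<bar> \<le> R" for u v k P Q R :: real
    proof -
      have "\<bar>u + v + k / 2\<bar> \<le> \<bar>u\<bar> + \<bar>v\<bar> + \<bar>k\<bar> / 2"
        by (simp add: abs_if)
      then have "4 * \<bar>u + v + k / 2\<bar> \<le> 4 * (\<bar>u\<bar> + \<bar>v\<bar> + \<bar>k\<bar> / 2)"
        by (rule mult_left_mono) simp
      also have "\<dots> \<le> P + Q + 2 * R"
        using that by (simp add: distrib_left)
      finally show ?thesis .
    qed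
    from this[OF ta tb w] show ?thesis by (simp add: power2_sum)
  qed
  then have "sqrt (4 * \<bar>t + t' + (x * y' - x' * y) / 2\<bar>) \<le> a + b"
    using nn by (intro real_le_lsqrt) auto
  then have 1: "2 * sqrt \<bar>t + t' + (x * y' - x' * y) / 2\<bar> \<le> a + b"
    by (simp add: real_sqrt_mult)
  have 2: "norm (x + x', y + y') \<le> a + b"
    using norm_triangle_ineq[of "(x, y)" "(x', y')"] a(1) b(1) by simp
  show ?thesis
    using 1 2 by (simp add: pq flip: a_def b_def) (simp add: a_def b_def pq)
qed

lemma heis_norm_inv: "heis_norm (heis_inv p) = heis_norm p"
  by (cases p) (simp add: norm_Pair)

lemma heis_norm_eq_0: "heis_norm p = 0 \<longleftrightarrow> p = 0"
proof -
  have "0 \<le> norm (x, y)" for x y :: real by simp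
  then show ?thesis
    by (cases p) (auto simp: max_def zero_prod_def not_le dest: antisym)
qed

lemma heis_norm_nonneg: "0 \<le> heis_norm p"
  by (cases p) (simp add: le_max_iff_disj)

lemma heis_inv_mult: "heis_inv (p \<odot> q) = heis_inv q \<odot> heis_inv p"
  by (cases p; cases q) (auto simp: field_simps)

lemma heis_inv_inv: "heis_inv (heis_inv p) = p"
  by (cases p) auto

lemma Metric_space_heis: "Metric_space UNIV heis_dist"
proof
  fix p q r :: heis
  show "0 \<le> heis_dist p q" by (simp add: heis_dist_def heis_norm_nonneg)
  show "heis_dist p q = heis_dist q p"
    unfolding heis_dist_def
    by (metis heis_norm_inv heis_inv_mult heis_inv_inv)
  show "heis_dist p q = 0 \<longleftrightarrow> p = q"
    unfolding heis_dist_def heis_norm_eq_0 by (metis heis_group)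
  have "heis_inv r \<odot> p = (heis_inv r \<odot> q) \<odot> (heis_inv q \<odot> p)"
    by (metis heis_group)
  then show "heis_dist p r \<le> heis_dist p q + heis_dist q r"
    unfolding heis_dist_def using heis_norm_mult by (metis add.commute)
qed

lemma continuous_heis_dist: "continuous_on UNIV (\<lambda>q. heis_dist p q)"
proof -
  have "(\<lambda>q. heis_dist p q) = (\<lambda>q. max (norm (fst p - fst q, fst (snd p) - fst (snd q)))
     (2 * sqrt \<bar>snd (snd p) - snd (snd q) + (fst p * fst (snd q) - fst q * fst (snd p)) / 2\<bar>))"
    by (rule ext, case_tac q, cases p) (auto simp: heis_dist_def algebra_simps)
  then show ?thesis
    by (simp only:) (intro continuous_intros; simp)
qed

lemma open_iff_heis_ball: "open U \<longleftrightarrow> (\<forall>p\<in>U. \<exists>r>0. heis_ball p r \<subseteq> U)"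
proof safe
  fix p assume U: "open U" "p \<in> U"
  obtain x y t where p: "p = (x, y, t)" by (metis prod_cases3)
  define f where "f = (\<lambda>w :: heis. (x + fst w, y + fst (snd w),
     t + snd (snd w) + (x * fst (snd w) - fst w * y) / 2))"
  have f: "f w = p \<odot> w" for w by (cases w) (simp add: f_def p)
  have "open (f -` U)"
    unfolding f_def by (intro open_vimage U continuous_intros) auto
  moreover have "0 \<in> f -` U"
    using U by (simp add: f heis_group)
  ultimately obtain e where e: "0 < e" "ball 0 e \<subseteq> f -` U"
    by (meson open_contains_ball)
  define r where "r = min 1 (e / 2)"
  have "heis_ball p r \<subseteq> U"
  proof
    fix q assume "q \<in> heis_ball p r"
    define w where "w = heis_inv p \<odot> q"
    have q: "q = f w" unfolding f w_def by (metis heis_group)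
    have "heis_dist q p < r"
      using \<open>q \<in> heis_ball p r\<close> Metric_space.commute[OF Metric_space_heis, of p q]
      by (simp add: heis_ball_def)
    then have n: "heis_norm w < r" by (simp add: heis_dist_def w_def)
    obtain a b c where w: "w = (a, b, c)" by (metis prod_cases3)
    have n1: "norm (a, b) < r" and n2: "2 * sqrt \<bar>c\<bar> < r"
      using n by (auto simp: w)
    have "0 \<le> sqrt \<bar>c\<bar>" by simp
    moreover have "sqrt \<bar>c\<bar> \<le> 1" using n2 \<open>0 \<le> sqrt \<bar>c\<bar>\<close> unfolding r_def by linarith
    ultimately have "sqrt \<bar>c\<bar> \<le> 1" "0 \<le> sqrt \<bar>c\<bar>" by blast+
    then have "sqrt \<bar>c\<bar> * sqrt \<bar>c\<bar> \<le> sqrt \<bar>c\<bar>"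
      by (intro mult_left_le)
    then have c: "\<bar>c\<bar> < r" using n2 \<open>0 \<le> sqrt \<bar>c\<bar>\<close> by (simp del: real_sqrt_ge_0_iff)
    have "norm w \<le> norm (a, b, 0::real) + norm (0::real, 0::real, c)"
      using norm_triangle_ineq[of "(a, b, 0::real)" "(0, 0, c)"] by (simp add: w)
    also have "\<dots> = norm (a, b) + \<bar>c\<bar>" by (simp add: norm_Pair)
    also have "\<dots> < e" using n1 c by (simp add: r_def)
    finally show "q \<in> U" using e q by auto
  qed
  moreover have "0 < r" using e by (simp add: r_def)
  ultimately show "\<exists>r>0. heis_ball p r \<subseteq> U" by blast
next
  assume *: "\<forall>p\<in>U. \<exists>r>0. heis_ball p r \<subseteq> U"
  show "open U"
  proof (subst open_subopen, safe)
    fix p assume "p \<in> U"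
    then obtain r where r: "0 < r" "heis_ball p r \<subseteq> U" using * by blast
    have "open (heis_ball p r)"
      unfolding heis_ball_def by (intro open_Collect_less continuous_heis_dist continuous_intros)
    moreover have "p \<in> heis_ball p r"
      using r Metric_space.mdist_zero[OF Metric_space_heis, of p] by (simp add: heis_ball_def)
    ultimately show "\<exists>T. open T \<and> p \<in> T \<and> T \<subseteq> U" using r by blast
  qed
qed


section \<open>Three-dimensional Hausdorff measure\<close>

text \<open>
  No normalising constant is used. Multiplying the measure by a positive constant only rescales
  regularity constants and beta numbers by controlled factors.
\<close>

definition hausdorff3_content :: "ennreal \<Rightarrow> heis set \<Rightarrow> ennreal" where
  "hausdorff3_content \<delta> A =
     (INF C \<in> {C :: nat \<Rightarrow> heis set. A \<subseteq> (\<Union>i. C i) \<and> (\<forall>i. heis_diam (C i) \<le> \<delta>)}.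
        \<Sum>i. heis_diam (C i) ^ 3)"

text \<open>As \<open>\<delta>\<close> decreases to \<open>0\<close> the content increases, so the limit is a supremum.\<close>

definition hausdorff3_outer :: "heis set \<Rightarrow> ennreal" where
  "hausdorff3_outer A = (SUP \<delta>\<in>{0<..}. hausdorff3_content \<delta> A)"

text \<open>
  Restriction of the outer measure to its Caratheodory measurable sets. These include all Borel
  sets, since Hausdorff outer measures are metric outer measures.
\<close>

definition hausdorff3 :: "heis measure" where
  "hausdorff3 = measure_of UNIV (lambda_system UNIV UNIV hausdorff3_outer) hausdorff3_outer"

lemma hausdorff3_content_UN:
  "hausdorff3_content \<delta> (\<Union>i. A i) \<le> (\<Sum>i. hausdorff3_content \<delta> (A i))"
proof (rule ennreal_le_epsilon)
  fix e :: real assume e: "0 < e" and fin: "(\<Sum>i. hausdorff3_content \<delta> (A i)) < top"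
  have "\<exists>C. A i \<subseteq> (\<Union>j. C j) \<and> (\<forall>j. heis_diam (C j) \<le> \<delta>) \<and>
     (\<Sum>j. heis_diam (C j) ^ 3) \<le> hausdorff3_content \<delta> (A i) + ennreal (e * (1/2) ^ Suc i)"
    for i :: nat
  proof -
    have "hausdorff3_content \<delta> (A i) < top"
      using fin ennreal_suminf_lessD by blast
    then have "hausdorff3_content \<delta> (A i)
        < hausdorff3_content \<delta> (A i) + ennreal (e * (1/2) ^ Suc i)"
      using e by (simp add: ennreal_add_left_cancel_less[of _ 0, simplified])
    then show ?thesis
      unfolding hausdorff3_content_def[of \<delta> "A i"] INF_less_iff
      by (force simp: hausdorff3_content_def intro: less_imp_le)
  qed
  then obtain C where C: "A i \<subseteq> (\<Union>j. C i j)" "\<And>j. heis_diam (C i j) \<le> \<delta>"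
     "(\<Sum>j. heis_diam (C i j) ^ 3) \<le> hausdorff3_content \<delta> (A i) + ennreal (e * (1/2) ^ Suc i)"
    for i :: nat by metis
  define D where "D = (\<lambda>n. C (fst (prod_decode n)) (snd (prod_decode n)))"
  have "(\<Union>i. A i) \<subseteq> (\<Union>n. D n)"
  proof
    fix p assume "p \<in> (\<Union>i. A i)"
    then obtain i j where "p \<in> C i j" using C(1) by blast
    then have "p \<in> D (prod_encode (i, j))" by (simp add: D_def)
    then show "p \<in> (\<Union>n. D n)" by blast
  qed
  moreover have "heis_diam (D n) \<le> \<delta>" for n
    unfolding D_def by (rule C(2))
  ultimately have "hausdorff3_content \<delta> (\<Union>i. A i) \<le> (\<Sum>n. heis_diam (D n) ^ 3)"
    unfolding hausdorff3_content_def[of \<delta> "\<Union>i. A i"] by (intro INF_lower CollectI conjI allI)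
  also have "\<dots> = (\<Sum>i. \<Sum>j. heis_diam (C i j) ^ 3)"
    using suminf_ennreal_2dimen[of "\<lambda>i. \<Sum>j. heis_diam (C i j) ^ 3"
        "\<lambda>q. heis_diam (C (fst q) (snd q)) ^ 3"]
    by (simp add: D_def)
  also have "\<dots> \<le> (\<Sum>i. hausdorff3_content \<delta> (A i) + ennreal (e * (1/2) ^ Suc i))"
    by (intro suminf_le C(3)) auto
  also have "\<dots> = (\<Sum>i. hausdorff3_content \<delta> (A i)) + (\<Sum>i. ennreal (e * (1/2) ^ Suc i))"
    by (intro suminf_add[symmetric]) auto
  also have "(\<Sum>i. ennreal (e * (1/2) ^ Suc i)) = ennreal e"
    using sums_mult[OF power_half_series, of e] e
    by (intro suminf_ennreal_eq) auto
  finally show "hausdorff3_content \<delta> (\<Union>i. A i) \<le> (\<Sum>i. hausdorff3_content \<delta> (A i)) + ennreal e" .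
qed

lemma outer_measure_space_hausdorff3: "outer_measure_space UNIV hausdorff3_outer"
  unfolding outer_measure_space_def
proof (intro conjI)
  have "hausdorff3_content \<delta> {} \<le> 0" for \<delta>
    unfolding hausdorff3_content_def
    by (rule INF_lower2[of "\<lambda>_. {}"]) (auto simp: heis_diam_def bot_ennreal)
  then show "positive UNIV hausdorff3_outer"
    unfolding positive_def hausdorff3_outer_def le_zero_eq[symmetric] by (rule SUP_least)
  show "increasing UNIV hausdorff3_outer"
    unfolding increasing_def hausdorff3_outer_def hausdorff3_content_def
    by (intro ballI impI SUP_mono' INF_superset_mono) auto
  show "countably_subadditive UNIV hausdorff3_outer"
    unfolding countably_subadditive_def
  proof (intro allI impI)
    fix A :: "nat \<Rightarrow> heis set"
    have "hausdorff3_content \<delta> (\<Union>i. A i) \<le> (\<Sum>i. hausdorff3_outer (A i))" if "0 < \<delta>" for \<delta>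
      using that
      by (intro order_trans[OF hausdorff3_content_UN] suminf_le)
         (auto simp: hausdorff3_outer_def intro: SUP_upper)
    then show "hausdorff3_outer (\<Union>i. A i) \<le> (\<Sum>i. hausdorff3_outer (A i))"
      by (subst hausdorff3_outer_def) (auto intro!: SUP_least)
  qed
qed

lemma
  shows sets_hausdorff3: "sets hausdorff3 = lambda_system UNIV UNIV hausdorff3_outer"
    and emeasure_hausdorff3: "A \<in> sets hausdorff3 \<Longrightarrow> emeasure hausdorff3 A = hausdorff3_outer A"
proof -
  interpret sigma_algebra UNIV "UNIV :: heis set set"
    using sigma_algebra_Pow[of UNIV] by simp
  have ms: "measure_space UNIV (lambda_system UNIV UNIV hausdorff3_outer) hausdorff3_outer"
    by (rule caratheodory_lemma[OF outer_measure_space_hausdorff3])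
  then interpret L: sigma_algebra UNIV "lambda_system UNIV UNIV hausdorff3_outer"
    by (simp add: measure_space_def)
  show S: "sets hausdorff3 = lambda_system UNIV UNIV hausdorff3_outer"
    by (simp add: hausdorff3_def L.sets_measure_of_eq)
  show "A \<in> sets hausdorff3 \<Longrightarrow> emeasure hausdorff3 A = hausdorff3_outer A"
    using ms unfolding S
    by (intro emeasure_measure_of[OF hausdorff3_def])
       (auto simp: S measure_space_def)
qed


section \<open>Regular sets, vertical perimeter and beta numbers\<close>

definition regular3 :: "real \<Rightarrow> heis set \<Rightarrow> bool" where
  "regular3 A E \<longleftrightarrow> closed E \<and> 1 \<le> A \<and>
     (\<forall>q\<in>E. \<forall>r::real. 0 < r \<and> ennreal r \<le> heis_diam E \<longrightarrow>
        ennreal (inverse A * r ^ 3) \<le> emeasure hausdorff3 (E \<inter> heis_ball q r) \<and>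
        emeasure hausdorff3 (E \<inter> heis_ball q r) \<le> ennreal (A * r ^ 3))"

definition vertical_perimeter :: "heis set \<Rightarrow> heis set \<Rightarrow> real \<Rightarrow> ennreal" where
  "vertical_perimeter \<Omega> U s =
     (\<integral>\<^sup>+p\<in>U. ennreal \<bar>indicator \<Omega> p - indicator \<Omega> (p \<odot> (0, 0, s\<^sup>2))\<bar> \<partial>lebesgue)"

definition vertical_subgroup :: "heis set \<Rightarrow> bool" where
  "vertical_subgroup W \<longleftrightarrow> subspace W \<and> dim W = 2 \<and> (\<forall>t. (0, 0, t) \<in> W)"

definition beta1 :: "heis set \<Rightarrow> heis \<Rightarrow> real \<Rightarrow> ennreal" where
  "beta1 E q r =
     (INF W \<in> {W. vertical_subgroup W}. INF z \<in> UNIV.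
        (\<integral>\<^sup>+x\<in>heis_ball q r \<inter> E. heis_setdist x ((\<lambda>w. z \<odot> w) ` W) / ennreal r \<partial>hausdorff3)
          / ennreal (r ^ 3))"

end

(* Let tilt measure the signed horizontal distance to a vertical plane. If q and q * (0,0,s^2) lie on
   different sides of the boundary E, join them by following the horizontal line through q, perpendicular
   to and away from the plane, then a vertical segment, then the translated horizontal line backwards;
   the path meets E. If it meets E on the vertical segment, E has a point at distance at least r from the
   plane, and regularity makes the beta number bounded below; when diam E < 24 r this is avoided by
   going out beyond E altogether. Otherwise one of the two horizontal rays meets E. The projection along
   horizontal lines onto the plane maps sets of diameter d to sets of area at most a constant times d^3,
   so the points whose outward ray meets a part of E at tilt about h fill a volume at most a constant
   times h times the Hausdorff measure of that part. Summing over dyadic h bounds the vertical perimeter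
   by the integral of tilt over E. *)

theory Submission
  imports Defs
begin

section \<open>Borel sets are Hausdorff measurable\<close>

lemma hausdorff3_outer_mono: "A \<subseteq> B \<Longrightarrow> hausdorff3_outer A \<le> hausdorff3_outer B"
  using outer_measure_space_hausdorff3 by (auto simp: outer_measure_space_def increasing_def)

lemma hausdorff3_outer_empty [simp]: "hausdorff3_outer {} = 0"
  using outer_measure_space_hausdorff3 by (auto simp: outer_measure_space_def positive_def)

text \<open>\<open>countably_subadditive\<close> speaks of disjoint families only. Making the family
  disjoint keeps the union and shrinks each member.\<close>

lemma hausdorff3_outer_UN_le:
  "hausdorff3_outer (\<Union>i. A i) \<le> (\<Sum>i. hausdorff3_outer (A i))" for A :: "nat \<Rightarrow> heis set"
proof -
  have csa: "countably_subadditive UNIV hausdorff3_outer"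
    using outer_measure_space_hausdorff3 by (auto simp: outer_measure_space_def)
  have "hausdorff3_outer (\<Union>i. disjointed A i) \<le> (\<Sum>i. hausdorff3_outer (disjointed A i))"
    using csa by (auto simp: countably_subadditive_def disjoint_family_disjointed)
  also have "\<dots> \<le> (\<Sum>i. hausdorff3_outer (A i))"
    by (intro suminf_le hausdorff3_outer_mono disjointed_subset) auto
  finally show ?thesis by (simp add: UN_disjointed_eq)
qed

lemma hausdorff3_outer_Un_le: "hausdorff3_outer (A \<union> B) \<le> hausdorff3_outer A + hausdorff3_outer B"
proof -
  have "hausdorff3_outer (A \<union> B) = hausdorff3_outer (\<Union>i. (\<lambda>i. if i = 0 then A else if i = Suc 0 then B else {}) i)"
    by (rule arg_cong[of _ _ hausdorff3_outer]) (auto split: if_splits)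
  also have "\<dots> \<le> (\<Sum>i. hausdorff3_outer (if i = 0 then A else if i = Suc 0 then B else {}))"
    by (rule hausdorff3_outer_UN_le)
  also have "\<dots> = (\<Sum>i\<in>{0, Suc 0}. hausdorff3_outer (if i = 0 then A else if i = Suc 0 then B else {}))"
    by (rule suminf_finite) auto
  finally show ?thesis by simp
qed

section \<open>Additivity on separated sets and Caratheodory's criterion\<close>

lemma heis_diam_upper: "p \<in> A \<Longrightarrow> q \<in> A \<Longrightarrow> ennreal (heis_dist p q) \<le> heis_diam A"
  unfolding heis_diam_def by (meson SUP_upper SUP_upper2)

lemma hausdorff3_content_antimono: "\<delta> \<le> \<epsilon> \<Longrightarrow> hausdorff3_content \<epsilon> A \<le> hausdorff3_content \<delta> A"
  unfolding hausdorff3_content_def by (intro INF_superset_mono) (auto intro: order_trans)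

text \<open>A set of diameter at most \<delta> cannot meet both \<open>A\<close> and
  \<open>B\<close>, so every admissible cover of the union splits into a cover of \<open>A\<close>
  and a cover of \<open>B\<close> that share no nonempty set.\<close>

lemma hausdorff3_content_separated:
  assumes sep: "\<And>x y. x \<in> A \<Longrightarrow> y \<in> B \<Longrightarrow> \<delta> < ennreal (heis_dist x y)"
  shows "hausdorff3_content \<delta> A + hausdorff3_content \<delta> B \<le> hausdorff3_content \<delta> (A \<union> B)"
  unfolding hausdorff3_content_def[of \<delta> "A \<union> B"]
proof (rule INF_greatest, clarify)
  fix C :: "nat \<Rightarrow> heis set"
  assume C: "A \<union> B \<subseteq> (\<Union>i. C i)" "\<forall>i. heis_diam (C i) \<le> \<delta>"
  \<comment> \<open>Sets missing \<open>S\<close> are replaced by the empty set, of diameter 0, so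
    that the subcover is still a sequence.\<close>
  define D where "D S i = (if C i \<inter> S = {} then {} else C i)" for S i
  have d0: "heis_diam {} = 0" by (simp add: heis_diam_def bot_ennreal)
  have le: "hausdorff3_content \<delta> S \<le> (\<Sum>i. heis_diam (D S i) ^ 3)" if S: "S \<subseteq> A \<union> B" for S
    unfolding hausdorff3_content_def
  proof (rule INF_lower, safe)
    fix x assume "x \<in> S"
    then obtain i where "x \<in> C i" using S C(1) by blast
    then have "x \<in> D S i" using \<open>x \<in> S\<close> by (auto simp: D_def)
    then show "x \<in> (\<Union>i. D S i)" by blast
  qed (use C(2) d0 in \<open>auto simp: D_def\<close>)
  have "hausdorff3_content \<delta> A + hausdorff3_content \<delta> B
      \<le> (\<Sum>i. heis_diam (D A i) ^ 3) + (\<Sum>i. heis_diam (D B i) ^ 3)"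
    by (intro add_mono le) auto
  also have "\<dots> = (\<Sum>i. heis_diam (D A i) ^ 3 + heis_diam (D B i) ^ 3)"
    by (rule suminf_add) auto
  also have "\<dots> \<le> (\<Sum>i. heis_diam (C i) ^ 3)"
  proof (intro suminf_le)
    fix i
    have "C i \<inter> A = {} \<or> C i \<inter> B = {}"
    proof (rule ccontr)
      assume "\<not> ?thesis"
      then obtain x y where "x \<in> C i" "x \<in> A" "y \<in> C i" "y \<in> B" by blast
      then have "\<delta> < heis_diam (C i)"
        using sep heis_diam_upper by (meson less_le_trans)
      then show False using C(2) by (simp add: leD)
    qed
    then show "heis_diam (D A i) ^ 3 + heis_diam (D B i) ^ 3 \<le> heis_diam (C i) ^ 3"
      by (auto simp: D_def d0)
  qed auto
  finally show "hausdorff3_content \<delta> A + hausdorff3_content \<delta> B \<le> (\<Sum>i. heis_diam (C i) ^ 3)" .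
qed

text \<open>Below the separation distance the contents are already superadditive; refining the mesh
  only increases them, so the two suprema may be taken one after the other.\<close>

lemma hausdorff3_outer_separated:
  fixes \<delta> :: real
  assumes \<delta>: "0 < \<delta>" and sep: "\<And>x y. x \<in> A \<Longrightarrow> y \<in> B \<Longrightarrow> \<delta> \<le> heis_dist x y"
  shows "hausdorff3_outer A + hausdorff3_outer B \<le> hausdorff3_outer (A \<union> B)"
proof -
  have 1: "hausdorff3_content d A + hausdorff3_content e B \<le> hausdorff3_outer (A \<union> B)"
    if "0 < d" "0 < e" for d e
  proof -
    \<comment> \<open>A mesh finer than both given ones; the half makes it strictly smaller than the
      separation.\<close>
    define m where "m = min (min d e) (ennreal (\<delta> / 2))"
    have "m \<le> ennreal (\<delta> / 2)" by (simp add: m_def)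
    also have "\<dots> < ennreal \<delta>" using \<delta> by (simp add: ennreal_lessI)
    finally have m: "m < ennreal (heis_dist x y)" if "x \<in> A" "y \<in> B" for x y
      using sep[OF that] by (meson ennreal_leI less_le_trans)
    have m0: "0 < m" using that \<delta> by (simp add: m_def)
    have "hausdorff3_content d A + hausdorff3_content e B \<le> hausdorff3_content m A + hausdorff3_content m B"
      by (intro add_mono hausdorff3_content_antimono) (auto simp: m_def intro: min.coboundedI1)
    also have "\<dots> \<le> hausdorff3_content m (A \<union> B)"
      by (rule hausdorff3_content_separated[OF m])
    also have "\<dots> \<le> hausdorff3_outer (A \<union> B)"
      unfolding hausdorff3_outer_def using m0 by (intro SUP_upper) auto
    finally show ?thesis .
  qed
  have ne: "{0::ennreal<..} \<noteq> {}" using zero_less_one by blast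
  have "hausdorff3_content d A + hausdorff3_outer B \<le> hausdorff3_outer (A \<union> B)" if "0 < d" for d
    unfolding hausdorff3_outer_def[of B]
    by (subst add.commute, subst ennreal_SUP_add_left[OF ne, symmetric], rule SUP_least,
        metis 1 that add.commute greaterThan_iff)
  then show ?thesis
    unfolding hausdorff3_outer_def[of A]
    by (subst ennreal_SUP_add_left[OF ne, symmetric]) (auto intro!: SUP_least)
qed

text \<open>Since \<open>f\<close> is 1-Lipschitz, rings on which its values are separated by a gap
  lie at positive distance. Adding one ring at a time, the separated case applies at each
  step.\<close>

lemma sum_le_hausdorff3_outer_rings:
  fixes R :: "nat \<Rightarrow> heis set"
  assumes lip: "\<And>x y. f x \<le> f y + heis_dist x y"
    and R: "\<And>k x. x \<in> R k \<Longrightarrow> x \<in> X \<and> l k < f x \<and> f x \<le> u k"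
    and lu: "\<And>j k. j < k \<Longrightarrow> u k < l j"
  shows "(\<Sum>k<n. hausdorff3_outer (R k)) \<le> hausdorff3_outer (\<Union>k<n. R k)"
proof (induction n)
  case (Suc n)
  have "hausdorff3_outer (\<Union>k<n. R k) + hausdorff3_outer (R n) \<le> hausdorff3_outer ((\<Union>k<n. R k) \<union> R n)"
  proof (cases "n = 0")
    case False
    \<comment> \<open>On all earlier rings \<open>f\<close> exceeds \<open>m\<close>, while on ring
      \<open>n\<close> it is at most \<open>u n\<close>.\<close>
    define m where "m = Min (l ` {..<n})"
    have "u n < m" unfolding m_def using False lu by (subst Min_gr_iff) auto
    show ?thesis
    proof (rule hausdorff3_outer_separated)
      show "0 < m - u n" using \<open>u n < m\<close> by simp
      fix x y assume "x \<in> (\<Union>k<n. R k)" "y \<in> R n"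
      then obtain k where k: "k < n" "x \<in> R k" by blast
      have "m \<le> l k" using k by (auto simp: m_def)
      then show "m - u n \<le> heis_dist x y"
        using R[OF k(2)] R[OF \<open>y \<in> R n\<close>] lip[of x y] by linarith
    qed
  qed simp
  also have "(\<Union>k<n. R k) \<union> R n = (\<Union>k<Suc n. R k)" by (auto simp: less_Suc_eq)
  finally show ?case using Suc.IH by (simp add: order_trans[OF add_right_mono])
qed simp

text \<open>Caratheodory's criterion: cutting \<open>{f > 0}\<close> into thin rings, those of even and those of odd
  index are separated families, so the tails of the series of their measures vanish.\<close>

lemma hausdorff3_lipschitz_sublevel:
  assumes lip: "\<And>x y. f x \<le> f y + heis_dist x y"
  shows "{x. f x \<le> 0} \<in> sets hausdorff3"
proof -
  let ?H = hausdorff3_outer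
  have "?H (F \<inter> X) + ?H ((UNIV - F) \<inter> X) \<le> ?H X" if F: "F = {x. f x \<le> 0}" for F X
  proof (cases "?H X = top")
    case False
    \<comment> \<open>Consecutive rings share the level \<open>1 / (k + 2)\<close> and need not be
      separated. Between rings whose indices differ by at least 2 there is a genuine gap, hence the
      split by parity.\<close>
    define R where "R k = {x \<in> X. 1 / real (k + 2) < f x \<and> f x \<le> 1 / real (k + 1)}" for k :: nat
    define G where "G n = {x \<in> X. 1 / real (n + 1) < f x}" for n :: nat
    have even: "(\<Sum>k<n. ?H (R (2 * k))) \<le> ?H (\<Union>k<n. R (2 * k))" for n
      by (rule sum_le_hausdorff3_outer_rings[OF lip, where X = X and l = "\<lambda>k. 1 / real (2 * k + 2)"
            and u = "\<lambda>k. 1 / real (2 * k + 1)"])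
         (auto simp: R_def intro!: divide_strict_left_mono)
    have odd: "(\<Sum>k<n. ?H (R (2 * k + 1))) \<le> ?H (\<Union>k<n. R (2 * k + 1))" for n
      by (rule sum_le_hausdorff3_outer_rings[OF lip, where X = X and l = "\<lambda>k. 1 / real (2 * k + 1 + 2)"
            and u = "\<lambda>k. 1 / real (2 * k + 1 + 1)"])
         (auto simp: R_def intro!: divide_strict_left_mono)
    have split: "(\<Sum>k<2 * n. ?H (R k)) = (\<Sum>k<n. ?H (R (2 * k))) + (\<Sum>k<n. ?H (R (2 * k + 1)))" for n
      by (induction n) (auto simp: algebra_simps)
    have "(\<Sum>k<n. ?H (R k)) \<le> ?H X + ?H X" for n
    proof -
      have "(\<Sum>k<n. ?H (R k)) \<le> (\<Sum>k<2 * n. ?H (R k))"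
        by (rule sum_mono2) auto
      also have "\<dots> \<le> ?H (\<Union>k<n. R (2 * k)) + ?H (\<Union>k<n. R (2 * k + 1))"
        unfolding split by (intro add_mono even odd)
      also have "\<dots> \<le> ?H X + ?H X"
        by (intro add_mono hausdorff3_outer_mono) (auto simp: R_def)
      finally show ?thesis .
    qed
    then have "(\<Sum>k. ?H (R k)) \<le> ?H X + ?H X" by (intro suminf_le_const) auto
    then have fin: "(\<Sum>k. ?H (R k)) < top" using False by (auto simp: less_top[symmetric] top_unique)
    show ?thesis
    proof (rule ennreal_le_epsilon)
      fix e :: real assume e: "0 < e"
      have lim: "(\<lambda>n. \<Sum>k<n. ?H (R k)) \<longlonglongrightarrow> (\<Sum>k. ?H (R k))"
        by (intro summable_LIMSEQ) auto
      \<comment> \<open>A convergent series has small tails. A zero total is treated apart, since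
        total minus \<open>e\<close> is then not strictly below the total.\<close>
      have "\<exists>n. (\<Sum>k. ?H (R (k + n))) \<le> ennreal e"
      proof (cases "(\<Sum>k. ?H (R k)) = 0")
        case True
        then show ?thesis using e by (intro exI[of _ 0]) simp
      next
        case False
        then have "(\<Sum>k. ?H (R k)) - ennreal e < (\<Sum>k. ?H (R k))"
          using fin e by (intro ennreal_between) (auto simp: zero_less_iff_neq_zero)
        from order_tendstoD(1)[OF lim this] obtain n where
          n: "(\<Sum>k. ?H (R k)) - ennreal e < (\<Sum>k<n. ?H (R k))"
          by (auto simp: eventually_sequentially)
        have eq: "(\<Sum>k. ?H (R k)) = (\<Sum>k. ?H (R (k + n))) + (\<Sum>k<n. ?H (R k))"
          by (rule suminf_offset) auto
        have "(\<Sum>k. ?H (R (k + n))) + (\<Sum>k<n. ?H (R k)) \<le> ennreal e + (\<Sum>k<n. ?H (R k))"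
          using n unfolding eq[symmetric] by (metis add.commute ennreal_minus_le_iff less_imp_le)
        moreover have "(\<Sum>k<n. ?H (R k)) \<noteq> top"
          using fin eq by (metis ennreal_add_eq_top less_irrefl)
        ultimately show ?thesis by (metis add.commute ennreal_add_left_cancel_le infinity_ennreal_def)
      qed
      then obtain n where n: "(\<Sum>k. ?H (R (k + n))) \<le> ennreal e" by blast
      \<comment> \<open>\<open>f\<close> is at most 0 on \<open>F\<close> and above
        \<open>1 / (n + 1)\<close> on \<open>G n\<close>, so these two sets are separated.\<close>
      have sep: "?H (F \<inter> X) + ?H (G n) \<le> ?H X"
      proof -
        have "?H (F \<inter> X) + ?H (G n) = ?H (G n) + ?H (F \<inter> X)" by (rule add.commute)
        also have "\<dots> \<le> ?H (G n \<union> F \<inter> X)"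
        proof (rule hausdorff3_outer_separated)
          show "0 < 1 / real (n + 1)" by simp
          fix x y assume "x \<in> G n" "y \<in> F \<inter> X"
          then show "1 / real (n + 1) \<le> heis_dist x y"
            using lip[of x y] by (auto simp: G_def F)
        qed
        also have "\<dots> \<le> ?H X" by (intro hausdorff3_outer_mono) (auto simp: G_def)
        finally show ?thesis .
      qed
      have "(UNIV - F) \<inter> X \<subseteq> G n \<union> (\<Union>k. R (k + n))"
      proof
        fix x assume x: "x \<in> (UNIV - F) \<inter> X"
        then have fx: "0 < f x" by (auto simp: F)
        show "x \<in> G n \<union> (\<Union>k. R (k + n))"
        proof (cases "x \<in> G n")
          case False
          then have le: "f x \<le> 1 / real (n + 1)" using x by (auto simp: G_def)
          \<comment> \<open>With this \<open>m\<close>, \<open>1 / (m + 1) < f x\<close> and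
            \<open>f x \<le> 1 / m\<close>, so \<open>x\<close> lies in ring \<open>m - 1\<close>;
            the index in the tail is \<open>m - 1 - n\<close>.\<close>
          define m where "m = nat \<lfloor>1 / f x\<rfloor>"
          have m: "real m \<le> 1 / f x" "1 / f x < real m + 1"
            using fx by (auto simp: m_def intro: of_int_floor_le)
          have "real (n + 1) \<le> 1 / f x" using le fx by (simp add: field_simps)
          then have "real (n + 1) < real m + 1" using m by linarith
          then have mn: "n + 1 \<le> m" by simp
          define k where "k = m - 1 - n"
          have k: "m = k + n + 1" using mn by (simp add: k_def)
          have "x \<in> R (k + n)" using x fx m by (auto simp: R_def k field_simps)
          then show ?thesis by blast
        qed simp
      qed
      then have "?H ((UNIV - F) \<inter> X) \<le> ?H (G n \<union> (\<Union>k. R (k + n)))"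
        by (rule hausdorff3_outer_mono)
      also have "\<dots> \<le> ?H (G n) + ?H (\<Union>k. R (k + n))" by (rule hausdorff3_outer_Un_le)
      also have "\<dots> \<le> ?H (G n) + ennreal e"
        by (intro add_left_mono order_trans[OF hausdorff3_outer_UN_le] n)
      finally have "?H (F \<inter> X) + ?H ((UNIV - F) \<inter> X) \<le> ?H (F \<inter> X) + (?H (G n) + ennreal e)"
        by (rule add_left_mono)
      also have "\<dots> \<le> ?H X + ennreal e"
        using sep by (simp add: add.assoc[symmetric] add_right_mono)
      finally show "?H (F \<inter> X) + ?H ((UNIV - F) \<inter> X) \<le> ?H X + ennreal e" .
    qed
  qed simp
  moreover have "?H X \<le> ?H (F \<inter> X) + ?H ((UNIV - F) \<inter> X)" for F X
  proof -
    have "F \<inter> X \<union> (UNIV - F) \<inter> X = X" by blast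
    then show ?thesis by (metis hausdorff3_outer_Un_le)
  qed
  ultimately show ?thesis
    unfolding sets_hausdorff3 lambda_system_def by (auto intro!: antisym)
qed

section \<open>Measurability of Borel sets\<close>

lemma space_hausdorff3 [simp]: "space hausdorff3 = UNIV"
  by (simp add: hausdorff3_def space_measure_of_conv)

lemma heis_dist_triangle: "heis_dist p r \<le> heis_dist p q + heis_dist q r"
  using Metric_space.triangle[OF Metric_space_heis] by blast

lemma heis_dist_nonneg [simp]: "0 \<le> heis_dist p q"
  by (simp add: heis_dist_def heis_norm_nonneg)

text \<open>A nonempty closed set is the zero sublevel of its distance function, which is
  1-Lipschitz: a point outside has a whole \<open>heis_ball\<close> missing the set, hence positive
  distance. Closed sets generate the Borel sets.\<close>

lemma borel_subset_hausdorff3: "sets borel \<subseteq> sets hausdorff3"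
proof -
  have "F \<in> sets hausdorff3" if F: "closed F" for F
  proof (cases "F = {}")
    case False
    define f where "f x = (INF y\<in>F. heis_dist x y)" for x
    have bdd: "bdd_below (heis_dist x ` F)" for x by (rule bdd_belowI[of _ 0]) auto
    have lip: "f x \<le> f y + heis_dist x y" for x y
    proof -
      have "f x - heis_dist x y \<le> f y"
        unfolding f_def[of y]
      proof (rule cINF_greatest[OF False])
        fix z assume "z \<in> F"
        then have "f x \<le> heis_dist x z" unfolding f_def by (intro cINF_lower bdd)
        also have "\<dots> \<le> heis_dist x y + heis_dist y z" by (rule heis_dist_triangle)
        finally show "f x - heis_dist x y \<le> heis_dist y z" by simp
      qed
      then show ?thesis by simp
    qed
    have "F = {x. f x \<le> 0}"
    proof safe
      fix x assume "x \<in> F"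
      then have "f x \<le> heis_dist x x" unfolding f_def by (intro cINF_lower bdd)
      then show "f x \<le> 0" using Metric_space.mdist_zero[OF Metric_space_heis, of x] by simp
    next
      fix x assume x: "f x \<le> 0"
      show "x \<in> F"
      proof (rule ccontr)
        assume "x \<notin> F"
        moreover have "open (- F)" using F by (simp add: open_Compl)
        ultimately obtain r where r: "r > 0" "heis_ball x r \<subseteq> - F"
          by (meson ComplI open_iff_heis_ball)
        have "r \<le> f x"
          unfolding f_def by (rule cINF_greatest[OF False]) (use r in \<open>force simp: heis_ball_def\<close>)
        then show False using r x by simp
      qed
    qed
    then show ?thesis using hausdorff3_lipschitz_sublevel[of f, OF lip] by simp
  qed simp
  then show ?thesis
    unfolding borel_eq_closed using sets.sigma_sets_subset[of "Collect closed" hausdorff3] by auto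
qed

section \<open>Shadows of horizontal rays\<close>

lemma nn_integral_lborel_rotation:
  fixes a b :: real and f :: "real \<Rightarrow> real \<Rightarrow> ennreal"
  assumes ab: "a\<^sup>2 + b\<^sup>2 = 1" and f: "case_prod f \<in> borel_measurable borel"
  shows "(\<integral>\<^sup>+x. \<integral>\<^sup>+y. f (a * x + b * y) (a * y - b * x) \<partial>lborel \<partial>lborel)
       = (\<integral>\<^sup>+u. \<integral>\<^sup>+v. f u v \<partial>lborel \<partial>lborel)"
proof -
  have [measurable]: "(\<lambda>x. f (g x) (h x)) \<in> borel_measurable M"
    if [measurable]: "g \<in> borel_measurable M" "h \<in> borel_measurable M" for g h and M :: "'m measure"
    using measurable_compose[OF _ f, of "\<lambda>x. (g x, h x)" M] by simp
  have [measurable]: "(\<lambda>x. f (g x) (h x)) \<in> borel_measurable M"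
    if [measurable]: "g \<in> borel_measurable M" "h \<in> borel_measurable M" for g h and M :: "(real \<times> real) measure"
    using measurable_compose[OF _ f, of "\<lambda>x. (g x, h x)" M] by simp
  have swap: "(\<integral>\<^sup>+x. \<integral>\<^sup>+y. f (g x y) (h x y) \<partial>lborel \<partial>lborel) = (\<integral>\<^sup>+y. \<integral>\<^sup>+x. f (g x y) (h x y) \<partial>lborel \<partial>lborel)"
    if [measurable]: "case_prod g \<in> borel_measurable (lborel \<Otimes>\<^sub>M lborel)" "case_prod h \<in> borel_measurable (lborel \<Otimes>\<^sub>M lborel)"
    for g h :: "real \<Rightarrow> real \<Rightarrow> real"
    by (rule lborel_pair.Fubini') measurable
  show ?thesis
  proof (cases "a = 0")
    case True
    \<comment> \<open>The rotation is a quarter turn here: a swap of the variables together with a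
      reflection.\<close>
    then have b: "\<bar>b\<bar> = 1" "b \<noteq> 0" using ab by (auto simp: power2_eq_1_iff)
    have "(\<integral>\<^sup>+x. \<integral>\<^sup>+y. f (a * x + b * y) (a * y - b * x) \<partial>lborel \<partial>lborel)
        = (\<integral>\<^sup>+x. \<integral>\<^sup>+y. f (b * y) (- b * x) \<partial>lborel \<partial>lborel)"
      by (simp add: True)
    also have "\<dots> = (\<integral>\<^sup>+x. \<integral>\<^sup>+y. f y (- b * x) \<partial>lborel \<partial>lborel)"
      using b by (subst (2) nn_integral_real_affine[where c = b and t = 0]) auto
    also have "\<dots> = (\<integral>\<^sup>+y. \<integral>\<^sup>+x. f y (- b * x) \<partial>lborel \<partial>lborel)"
      by (rule swap) auto
    also have "\<dots> = (\<integral>\<^sup>+y. \<integral>\<^sup>+x. f y x \<partial>lborel \<partial>lborel)"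
      using b by (subst (4) nn_integral_real_affine[where c = "- b" and t = 0]) auto
    finally show ?thesis .
  next
    case False
    \<comment> \<open>For fixed \<open>y\<close>, substitute \<open>u = a x + b y\<close>. By
      \<open>a^2 + b^2 = 1\<close> the second argument \<open>a y - b x\<close> becomes
      \<open>(y - b u) / a\<close>.\<close>
    have 1: "(\<integral>\<^sup>+u. f u ((y - b * u) / a) \<partial>lborel)
        = ennreal \<bar>a\<bar> * (\<integral>\<^sup>+x. f (a * x + b * y) (a * y - b * x) \<partial>lborel)" for y
    proof -
      have "(y - b * (b * y + a * x)) / a = a * y - b * x" for x
      proof -
        have "y - b * (b * y + a * x) = (a\<^sup>2 + b\<^sup>2) * y - b * (b * y + a * x)" by (simp add: ab)
        also have "\<dots> = a * (a * y - b * x)" by (simp add: algebra_simps power2_eq_square)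
        finally show ?thesis using False by simp
      qed
      then show ?thesis
        by (subst nn_integral_real_affine[where c = a and t = "b * y"])
           (auto simp: False add.commute)
    qed
    \<comment> \<open>For fixed \<open>u\<close>, substitute \<open>y = a v + b u\<close>. The
      factor \<open>\<bar>a\<bar>\<close> is the same as in the first substitution, so the two
      cancel.\<close>
    have 2: "(\<integral>\<^sup>+y. f u ((y - b * u) / a) \<partial>lborel) = ennreal \<bar>a\<bar> * (\<integral>\<^sup>+v. f u v \<partial>lborel)" for u
      by (subst nn_integral_real_affine[where c = a and t = "b * u"]) (auto simp: False)
    have "ennreal \<bar>a\<bar> * (\<integral>\<^sup>+x. \<integral>\<^sup>+y. f (a * x + b * y) (a * y - b * x) \<partial>lborel \<partial>lborel)
        = ennreal \<bar>a\<bar> * (\<integral>\<^sup>+y. \<integral>\<^sup>+x. f (a * x + b * y) (a * y - b * x) \<partial>lborel \<partial>lborel)"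
      by (subst swap) auto
    also have "\<dots> = (\<integral>\<^sup>+y. \<integral>\<^sup>+u. f u ((y - b * u) / a) \<partial>lborel \<partial>lborel)"
      unfolding 1 by (rule nn_integral_cmult[symmetric]) measurable
    also have "\<dots> = (\<integral>\<^sup>+u. \<integral>\<^sup>+y. f u ((y - b * u) / a) \<partial>lborel \<partial>lborel)"
      by (rule swap) auto
    also have "\<dots> = ennreal \<bar>a\<bar> * (\<integral>\<^sup>+u. \<integral>\<^sup>+v. f u v \<partial>lborel \<partial>lborel)"
      unfolding 2 by (rule nn_integral_cmult) measurable
    finally show ?thesis
      using False by (simp add: ennreal_mult_cancel_left)
  qed
qed

text \<open>A rotated box with sides \<open>h\<close>, \<open>2 d\<close>, \<open>2 \<delta>\<close>
  whose vertical fibres are recentred at height \<open>\<phi> x y\<close>. The side in the direction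
  \<open>(a, b)\<close> is open at \<open>c\<close>, matching the strict condition
  \<open>0 < tilt a b c q\<close> on shadows.\<close>

definition sheared_box :: "real \<Rightarrow> real \<Rightarrow> real \<Rightarrow> real \<Rightarrow> real \<Rightarrow> real \<Rightarrow> real \<Rightarrow> (real \<Rightarrow> real \<Rightarrow> real) \<Rightarrow> heis set" where
  "sheared_box a b c h v d \<delta> \<phi> = {(x, y, t). c < a * x + b * y \<and> a * x + b * y \<le> c + h \<and>
     \<bar>a * y - b * x - v\<bar> \<le> d \<and> \<bar>t - \<phi> x y\<bar> \<le> \<delta>}"

text \<open>Integrating in \<open>t\<close> first, every nonempty fibre has length
  \<open>2 \<delta>\<close> whatever \<phi> is; the rotation then turns the remaining planar region
  into a rectangle.\<close>

lemma
  assumes ab: "a\<^sup>2 + b\<^sup>2 = 1" and nn: "0 \<le> h" "0 \<le> d" "0 \<le> \<delta>"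
    and \<phi>: "case_prod \<phi> \<in> borel_measurable borel"
  shows sets_sheared_box: "sheared_box a b c h v d \<delta> \<phi> \<in> sets borel"
    and emeasure_sheared_box: "emeasure lborel (sheared_box a b c h v d \<delta> \<phi>) = ennreal (h * (2 * d) * (2 * \<delta>))"
proof -
  let ?B = "sheared_box a b c h v d \<delta> \<phi>"
  have "(\<lambda>q :: heis. (fst q, fst (snd q))) \<in> borel_measurable borel"
    by (intro borel_measurable_continuous_onI continuous_intros)
  then have [measurable]: "(\<lambda>q. \<phi> (fst q) (fst (snd q))) \<in> borel_measurable (borel :: heis measure)"
    using measurable_compose[OF _ \<phi>, of "\<lambda>q :: heis. (fst q, fst (snd q))"] by simp
  have B: "?B = {q. c < a * fst q + b * fst (snd q) \<and> a * fst q + b * fst (snd q) \<le> c + h \<and>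
     \<bar>a * fst (snd q) - b * fst q - v\<bar> \<le> d \<and> \<bar>snd (snd q) - \<phi> (fst q) (fst (snd q))\<bar> \<le> \<delta>}"
    by (auto simp: sheared_box_def)
  have [measurable]: "(\<lambda>q. a * fst q + b * fst (snd q)) \<in> borel_measurable (borel :: heis measure)"
    "(\<lambda>q. a * fst (snd q) - b * fst q) \<in> borel_measurable (borel :: heis measure)"
    "(\<lambda>q. snd (snd q)) \<in> borel_measurable (borel :: heis measure)"
    by (intro borel_measurable_continuous_onI continuous_intros)+
  show S: "?B \<in> sets borel" unfolding B by measurable
  let ?f = "\<lambda>u v'. indicator {c<..c + h} u * indicator {v - d..v + d} v' :: ennreal"
  have fm: "(\<lambda>(u, w). ennreal (2 * \<delta>) * ?f u w) \<in> borel_measurable borel"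
    unfolding case_prod_beta borel_prod[symmetric] by measurable
  have Bm: "indicator ?B \<in> borel_measurable (lborel \<Otimes>\<^sub>M lborel :: heis measure)"
    using S by (simp add: lborel_prod)
  have "emeasure lborel ?B = (\<integral>\<^sup>+q. indicator ?B q \<partial>(lborel \<Otimes>\<^sub>M lborel))"
    using S by (simp add: lborel_prod)
  also have "\<dots> = (\<integral>\<^sup>+x. \<integral>\<^sup>+w. indicator ?B (x, w) \<partial>lborel \<partial>lborel)"
    by (rule lborel.nn_integral_fst[symmetric, OF Bm])
  also have "\<dots> = (\<integral>\<^sup>+x. \<integral>\<^sup>+w. indicator ?B (x, w) \<partial>(lborel \<Otimes>\<^sub>M lborel) \<partial>lborel)"
    by (simp add: lborel_prod)
  also have "\<dots> = (\<integral>\<^sup>+x. \<integral>\<^sup>+y. \<integral>\<^sup>+t. indicator ?B (x, y, t) \<partial>lborel \<partial>lborel \<partial>lborel)"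
  proof (rule nn_integral_cong)
    fix x :: real
    have "(\<lambda>w. indicator ?B (x, w) :: ennreal) \<in> borel_measurable (lborel \<Otimes>\<^sub>M lborel)"
      using measurable_compose[OF measurable_Pair1' Bm, of x] by (simp add: lborel_prod)
    from lborel.nn_integral_fst[symmetric, OF this]
    show "(\<integral>\<^sup>+w. indicator ?B (x, w) \<partial>(lborel \<Otimes>\<^sub>M lborel)) = (\<integral>\<^sup>+y. \<integral>\<^sup>+t. indicator ?B (x, y, t) \<partial>lborel \<partial>lborel)"
      by simp
  qed
  also have "\<dots> = (\<integral>\<^sup>+x. \<integral>\<^sup>+y. ennreal (2 * \<delta>) * ?f (a * x + b * y) (a * y - b * x) \<partial>lborel \<partial>lborel)"
  proof (intro nn_integral_cong)
    fix x y :: real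
    have "(\<integral>\<^sup>+t. indicator ?B (x, y, t) \<partial>lborel) =
      (\<integral>\<^sup>+t. ?f (a * x + b * y) (a * y - b * x) * indicator {\<phi> x y - \<delta>..\<phi> x y + \<delta>} t \<partial>lborel)"
      by (intro nn_integral_cong) (auto simp: sheared_box_def indicator_def abs_le_iff)
    also have "\<dots> = ?f (a * x + b * y) (a * y - b * x) * ennreal (2 * \<delta>)"
      using nn by (subst nn_integral_cmult_indicator) auto
    finally show "(\<integral>\<^sup>+t. indicator ?B (x, y, t) \<partial>lborel) = ennreal (2 * \<delta>) * ?f (a * x + b * y) (a * y - b * x)"
      by (simp add: mult.commute)
  qed
  also have "\<dots> = (\<integral>\<^sup>+u. \<integral>\<^sup>+w. ennreal (2 * \<delta>) * ?f u w \<partial>lborel \<partial>lborel)"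
    by (rule nn_integral_lborel_rotation[OF ab fm])
  also have "\<dots> = (\<integral>\<^sup>+u. ennreal (2 * \<delta>) * ennreal (2 * d) * indicator {c<..c + h} u \<partial>lborel)"
  proof (intro nn_integral_cong)
    fix u :: real
    have "(\<integral>\<^sup>+w. ennreal (2 * \<delta>) * ?f u w \<partial>lborel)
      = (\<integral>\<^sup>+w. (ennreal (2 * \<delta>) * indicator {c<..c + h} u) * indicator {v - d..v + d} w \<partial>lborel)"
      by (simp add: mult.assoc)
    also have "\<dots> = (ennreal (2 * \<delta>) * indicator {c<..c + h} u) * ennreal (2 * d)"
      using nn by (subst nn_integral_cmult_indicator) auto
    finally show "(\<integral>\<^sup>+w. ennreal (2 * \<delta>) * ?f u w \<partial>lborel) = ennreal (2 * \<delta>) * ennreal (2 * d) * indicator {c<..c + h} u"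
      by (simp add: mult_ac)
  qed
  also have "\<dots> = ennreal (2 * \<delta>) * ennreal (2 * d) * ennreal h"
    using nn by (subst nn_integral_cmult_indicator) auto
  also have "\<dots> = ennreal (h * (2 * d) * (2 * \<delta>))"
    using nn by (simp add: ennreal_mult[symmetric] mult_ac)
  finally show "emeasure lborel ?B = ennreal (h * (2 * d) * (2 * \<delta>))" .
qed

section \<open>Projection along horizontal lines and the shadow estimate\<close>

definition tilt :: "real \<Rightarrow> real \<Rightarrow> real \<Rightarrow> heis \<Rightarrow> real" where
  "tilt a b c q = a * fst q + b * fst (snd q) - c"

text \<open>In coordinates \<open>u = a x + b y\<close>, \<open>v = a y - b x\<close> the horizontal lines in direction \<open>(a, b)\<close> are
  the level sets of \<open>(v, t + u v / 2)\<close>; the image of a ball of radius \<open>d\<close> under this map lies in a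
  parallelogram of area comparable to \<open>d\<^sup>3\<close>.\<close>

lemma ray_in_box:
  assumes ab: "a\<^sup>2 + b\<^sup>2 = 1" and near: "heis_dist (q \<odot> (\<tau> * a, \<tau> * b, 0)) (x0, y0, t0) \<le> d"
    and "0 \<le> \<tau>" "0 < tilt a b c q" "tilt a b c (q \<odot> (\<tau> * a, \<tau> * b, 0)) \<le> h"
  shows "q \<in> sheared_box a b c h (a * y0 - b * x0) d (d\<^sup>2)
    (\<lambda>x y. t0 + (a * x0 + b * y0) * (a * y0 - b * x0) / 2
       + (a * x0 + b * y0) * ((a * y - b * x) - (a * y0 - b * x0)) - (a * x + b * y) * (a * y - b * x) / 2)"
proof -
  obtain x y t where q: "q = (x, y, t)" by (metis prod_cases3)
  \<comment> \<open>\<open>(p, r, m)\<close> is the position of the end of the ray relative to the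
    centre of the ball.\<close>
  define p where "p = x + \<tau> * a - x0"
  define r where "r = y + \<tau> * b - y0"
  define m where "m = t + (x * (\<tau> * b) - \<tau> * a * y) / 2 - t0 + (p * y0 - x0 * r) / 2"
  have "heis_inv (x0, y0, t0) \<odot> (q \<odot> (\<tau> * a, \<tau> * b, 0)) = (p, r, m)"
    by (simp add: q p_def r_def m_def field_simps)
  then have n: "norm (p, r) \<le> d" "2 * sqrt \<bar>m\<bar> \<le> d"
    using near by (auto simp: heis_dist_def)
  have d0: "0 \<le> d" using n(1) norm_ge_zero order_trans by blast
  have pr: "p\<^sup>2 + r\<^sup>2 \<le> d\<^sup>2"
    using power_mono[OF n(1), of 2] by (simp add: norm_Pair)
  have m4: "4 * \<bar>m\<bar> \<le> d\<^sup>2"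
    using power_mono[OF n(2), of 2] by (simp add: power_mult_distrib)
  \<comment> \<open>\<open>a'\<close> and \<open>b'\<close> are the components of
    \<open>(p, r)\<close> along and across the ray; the rotation preserves the length.\<close>
  define a' where "a' = a * p + b * r"
  define b' where "b' = a * r - b * p"
  have "a'\<^sup>2 + b'\<^sup>2 = (a\<^sup>2 + b\<^sup>2) * (p\<^sup>2 + r\<^sup>2)"
    by (simp add: a'_def b'_def power2_eq_square algebra_simps)
  then have ab': "a'\<^sup>2 + b'\<^sup>2 \<le> d\<^sup>2" using pr ab by simp
  then have "b'\<^sup>2 \<le> d\<^sup>2" using zero_le_power2[of a'] by linarith
  then have b'd: "\<bar>b'\<bar> \<le> d" using d0 by (simp add: abs_le_square_iff[symmetric])
  have "2 * \<bar>a' * b'\<bar> \<le> a'\<^sup>2 + b'\<^sup>2"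
    using sum_squares_bound[of "\<bar>a'\<bar>" "\<bar>b'\<bar>"] by (simp add: abs_mult)
  then have a'b': "2 * \<bar>a' * b'\<bar> \<le> d\<^sup>2" using ab' by linarith
  have v: "a * y - b * x - (a * y0 - b * x0) = b'"
    by (simp add: b'_def p_def r_def algebra_simps)
  \<comment> \<open>Apart from the linear term in \<open>b'\<close>, this compares
    \<open>t + u v / 2\<close> at \<open>q\<close> and at the centre. That quantity is constant
    along the ray, so \<tau> cancels and only data of the end point remain.\<close>
  have t: "t - (t0 + (a * x0 + b * y0) * (a * y0 - b * x0) / 2 + (a * x0 + b * y0) * b'
      - (a * x + b * y) * (a * y - b * x) / 2) = m + a' * b' / 2"
  proof -
    have "a' = (a * x + b * y) - (a * x0 + b * y0) + \<tau> * (a\<^sup>2 + b\<^sup>2)"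
      by (simp add: a'_def p_def r_def power2_eq_square algebra_simps)
    then have u': "a * x + b * y = a * x0 + b * y0 + a' - \<tau>" by (simp add: ab)
    have v': "a * y - b * x = a * y0 - b * x0 + b'" using v by simp
    have m1: "x * (\<tau> * b) - \<tau> * a * y = - \<tau> * (a * y - b * x)" by (simp add: algebra_simps)
    have "p * y0 - x0 * r = (a\<^sup>2 + b\<^sup>2) * (p * y0 - x0 * r)" by (simp add: ab)
    also have "\<dots> = a' * (a * y0 - b * x0) - (a * x0 + b * y0) * b'"
      by (simp add: a'_def b'_def power2_eq_square algebra_simps)
    finally have m2: "p * y0 - x0 * r = a' * (a * y0 - b * x0) - (a * x0 + b * y0) * b'" .
    have "t - (t0 + u * w / 2 + u * b' - (u + a' - \<tau>) * (w + b') / 2)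
      = t + (- \<tau> * (w + b')) / 2 - t0 + (a' * w - u * b') / 2 + a' * b' / 2" for u w
      by (simp add: field_simps)
    from this[of "a * x0 + b * y0" "a * y0 - b * x0"] show ?thesis
      unfolding m_def m1 m2 u' v' .
  qed
  have "\<bar>m + a' * b' / 2\<bar> \<le> \<bar>m\<bar> + \<bar>a' * b'\<bar> / 2"
    by (simp add: abs_if)
  also have "\<dots> \<le> d\<^sup>2" using m4 a'b' zero_le_power2[of d] by linarith
  finally have "\<bar>m + a' * b' / 2\<bar> \<le> d\<^sup>2" .
  moreover have "tilt a b c (q \<odot> (\<tau> * a, \<tau> * b, 0)) = tilt a b c q + \<tau>"
  proof -
    have "tilt a b c (q \<odot> (\<tau> * a, \<tau> * b, 0)) = tilt a b c q + \<tau> * (a\<^sup>2 + b\<^sup>2)"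
      by (simp add: q tilt_def power2_eq_square algebra_simps)
    then show ?thesis by (simp add: ab)
  qed
  ultimately show ?thesis
    using assms(3-5) b'd unfolding q sheared_box_def
    by (simp add: v t tilt_def)
qed

lemma ennreal_divide_leD:
  assumes "0 < c" "x / ennreal c \<le> y"
  shows "x \<le> ennreal c * y"
proof -
  have "x = ennreal c * (x / ennreal c)"
    using assms(1) by (simp add: ennreal_times_divide mult.commute mult_divide_eq_ennreal)
  also have "\<dots> \<le> ennreal c * y" by (intro mult_left_mono assms) simp
  finally show ?thesis .
qed

text \<open>Cover \<open>K\<close> by sets \<open>C i\<close>. Points of the slab whose ray hits
  \<open>C i\<close> lie in a sheared box of volume \<open>4 h\<close> times the cube of the
  diameter; summing over \<open>i\<close> gives the Hausdorff sum of the cover.\<close>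

lemma ray_shadow_slab:
  assumes ab: "a\<^sup>2 + b\<^sup>2 = 1" and h: "0 < h"
  shows "\<exists>T\<in>sets lborel.
    {q. 0 < tilt a b c q \<and> (\<exists>\<tau>\<ge>0. q \<odot> (\<tau> * a, \<tau> * b, 0) \<in> K \<and> tilt a b c (q \<odot> (\<tau> * a, \<tau> * b, 0)) \<le> h)} \<subseteq> T \<and>
    emeasure lborel T \<le> ennreal (4 * h) * hausdorff3_outer K"
proof -
  define sh where "sh X = {q. 0 < tilt a b c q \<and>
    (\<exists>\<tau>\<ge>0. q \<odot> (\<tau> * a, \<tau> * b, 0) \<in> X \<and> tilt a b c (q \<odot> (\<tau> * a, \<tau> * b, 0)) \<le> h)}" for X
  define S where "S = sh K"
  \<comment> \<open>The shadow need not be measurable. A measurable hull fixed before the cover lets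
    the bound pass to the infimum over covers.\<close>
  obtain T where T: "T \<in> sets lborel" "S \<subseteq> T" "outer_measure_of lborel S = emeasure lborel T"
    using outer_measure_of_attain[of S lborel] by auto
  have cover: "emeasure lborel T \<le> ennreal (4 * h) * (\<Sum>i. heis_diam (C i) ^ 3)"
    if C: "K \<subseteq> (\<Union>i. C i)" "\<And>i. heis_diam (C i) \<le> 1" for C :: "nat \<Rightarrow> heis set"
  proof -
    have "\<exists>B. B \<in> sets borel \<and> emeasure lborel B \<le> ennreal (4 * h) * heis_diam (C i) ^ 3 \<and>
      sh (C i) \<subseteq> B"
      for i
    proof (cases "C i = {}")
      case True
      then show ?thesis by (intro exI[of _ "{}"]) (auto simp: sh_def)
    next
      case False
      then obtain x0 y0 t0 where e0: "(x0, y0, t0) \<in> C i" by (metis all_not_in_conv prod_cases3)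
      \<comment> \<open>The diameter is finite because the covers have mesh at most 1.\<close>
      define d where "d = enn2real (heis_diam (C i))"
      have d: "ennreal d = heis_diam (C i)" "0 \<le> d"
        using C(2)[of i] by (auto simp: d_def ennreal_enn2real_if top_unique)
      define \<phi> where "\<phi> = (\<lambda>x y. t0 + (a * x0 + b * y0) * (a * y0 - b * x0) / 2
       + (a * x0 + b * y0) * ((a * y - b * x) - (a * y0 - b * x0)) - (a * x + b * y) * (a * y - b * x) / 2)"
      have \<phi>: "case_prod \<phi> \<in> borel_measurable borel"
        unfolding \<phi>_def case_prod_beta'
        by (rule borel_measurable_continuous_onI) (auto intro!: continuous_intros)
      define B where "B = sheared_box a b c h (a * y0 - b * x0) d (d\<^sup>2) \<phi>"
      have "B \<in> sets borel" unfolding B_def using h d by (intro sets_sheared_box[OF ab _ _ _ \<phi>]) auto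
      moreover have "emeasure lborel B = ennreal (h * (2 * d) * (2 * d\<^sup>2))"
        unfolding B_def using h d by (intro emeasure_sheared_box[OF ab _ _ _ \<phi>]) auto
      then have "emeasure lborel B = ennreal (4 * h * d ^ 3)"
        by (simp add: power2_eq_square power3_eq_cube mult_ac)
      then have "emeasure lborel B = ennreal (4 * h) * heis_diam (C i) ^ 3"
        using h d(2) by (simp add: ennreal_mult ennreal_power d(1)[symmetric])
      moreover have "q \<in> B" if "0 < tilt a b c q" "0 \<le> \<tau>" "q \<odot> (\<tau> * a, \<tau> * b, 0) \<in> C i"
        "tilt a b c (q \<odot> (\<tau> * a, \<tau> * b, 0)) \<le> h" for q \<tau>
      proof -
        have "ennreal (heis_dist (q \<odot> (\<tau> * a, \<tau> * b, 0)) (x0, y0, t0)) \<le> ennreal d"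
          unfolding d by (rule heis_diam_upper[OF that(3) e0])
        then have "heis_dist (q \<odot> (\<tau> * a, \<tau> * b, 0)) (x0, y0, t0) \<le> d"
          using d(2) by simp
        from ray_in_box[OF ab this that(2,1,4)] show ?thesis by (simp add: B_def \<phi>_def)
      qed
      ultimately show ?thesis by (intro exI[of _ B]) (auto simp: sh_def)
    qed
    then obtain B where B: "\<And>i. B i \<in> sets borel"
      "\<And>i. emeasure lborel (B i) \<le> ennreal (4 * h) * heis_diam (C i) ^ 3"
      "\<And>i. sh (C i) \<subseteq> B i"
      by (metis order_refl)
    have "S \<subseteq> (\<Union>i. B i)"
    proof
      fix q assume "q \<in> S"
      then obtain \<tau> where q: "0 < tilt a b c q" "0 \<le> \<tau>" "q \<odot> (\<tau> * a, \<tau> * b, 0) \<in> K" "tilt a b c (q \<odot> (\<tau> * a, \<tau> * b, 0)) \<le> h"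
        by (auto simp: S_def sh_def)
      then obtain i where "q \<odot> (\<tau> * a, \<tau> * b, 0) \<in> C i" using C(1) by blast
      then show "q \<in> (\<Union>i. B i)" using q B(3)[of i] by (auto simp: sh_def)
    qed
    then have "emeasure lborel T \<le> emeasure lborel (\<Union>i. B i)"
      unfolding T(3)[symmetric] outer_measure_of_def using B(1) by (intro INF_lower) auto
    also have "\<dots> \<le> (\<Sum>i. emeasure lborel (B i))"
      using B(1) by (intro emeasure_subadditive_countably) auto
    also have "\<dots> \<le> (\<Sum>i. ennreal (4 * h) * heis_diam (C i) ^ 3)"
      by (intro suminf_le B) auto
    also have "\<dots> = ennreal (4 * h) * (\<Sum>i. heis_diam (C i) ^ 3)" by simp
    finally show ?thesis .
  qed
  have "emeasure lborel T / ennreal (4 * h) \<le> hausdorff3_content 1 K"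
    unfolding hausdorff3_content_def using h cover
    by (intro INF_greatest divide_le_posI_ennreal) auto
  also have "\<dots> \<le> hausdorff3_outer K"
    unfolding hausdorff3_outer_def by (rule SUP_upper) auto
  finally have "emeasure lborel T \<le> ennreal (4 * h) * hausdorff3_outer K"
    using h by (intro ennreal_divide_leD) auto
  then show ?thesis using T(1,2) unfolding S_def sh_def by auto
qed

text \<open>On \<open>F n\<close> the tilt lies between \<open>l n\<close> and
  \<open>2 * l n\<close>, so its slab shadow has measure at most \<open>8 * l n\<close> times the
  measure of \<open>F n\<close>, hence at most 8 times the integral of the tilt there. Since
  \<open>ennreal\<close> sends negative numbers to 0, only positive tilts contribute.\<close>

lemma ray_shadow:
  assumes ab: "a\<^sup>2 + b\<^sup>2 = 1" and E: "E \<in> sets hausdorff3"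
  shows "\<exists>T\<in>sets lborel.
    {q. 0 < tilt a b c q \<and> (\<exists>\<tau>\<ge>0. q \<odot> (\<tau> * a, \<tau> * b, 0) \<in> E)} \<subseteq> T \<and>
    emeasure lborel T \<le> 8 * (\<integral>\<^sup>+x\<in>E. ennreal (tilt a b c x) \<partial>hausdorff3)"
proof -
  let ?g = "tilt a b c"
  have "?g \<in> borel_measurable borel"
    unfolding tilt_def by (intro borel_measurable_continuous_onI continuous_intros)
  then have g[measurable]: "?g \<in> borel_measurable hausdorff3"
    using borel_subset_hausdorff3 by (auto simp: measurable_def)
  \<comment> \<open>\<open>int_decode\<close> enumerates all integers, so arbitrarily small and
    large dyadic scales occur in one sequence.\<close>
  define l where "l n = 2 powr real_of_int (int_decode n)" for n
  define F where "F n = {x \<in> E. l n \<le> ?g x \<and> ?g x < 2 * l n}" for n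
  have l0: "0 < l n" for n by (simp add: l_def)
  have F[measurable]: "F n \<in> sets hausdorff3" for n
  proof -
    have "F n = E \<inter> {x \<in> space hausdorff3. l n \<le> ?g x \<and> ?g x < 2 * l n}" by (auto simp: F_def)
    also have "\<dots> \<in> sets hausdorff3" by (intro sets.Int E) measurable
    finally show ?thesis .
  qed
  have uniq: "int_decode n = \<lfloor>log 2 (?g x)\<rfloor>" if "x \<in> F n" for n x
  proof -
    have gx: "0 < ?g x" using that l0[of n] by (auto simp: F_def)
    have "2 * l n = 2 powr (real_of_int (int_decode n) + 1)" by (simp add: l_def powr_add)
    then show ?thesis
      using that gx by (subst eq_commute) (auto simp: F_def l_def floor_log_eq_powr_iff)
  qed
  have disj: "disjoint_family F"
    unfolding disjoint_family_on_def using uniq by (metis Int_iff all_not_in_conv int_decode_inverse)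
  have UN: "x \<in> (\<Union>n. F n)" if "x \<in> E" "0 < ?g x" for x
  proof -
    define n where "n = int_encode \<lfloor>log 2 (?g x)\<rfloor>"
    have "2 * l n = 2 powr (real_of_int \<lfloor>log 2 (?g x)\<rfloor> + 1)" by (simp add: l_def n_def powr_add)
    then have "x \<in> F n"
      using that floor_log_eq_powr_iff[of "?g x" 2 "\<lfloor>log 2 (?g x)\<rfloor>"]
      by (auto simp: F_def l_def n_def)
    then show ?thesis by blast
  qed
  define sh where "sh n = {q. 0 < ?g q \<and>
    (\<exists>\<tau>\<ge>0. q \<odot> (\<tau> * a, \<tau> * b, 0) \<in> F n \<and> ?g (q \<odot> (\<tau> * a, \<tau> * b, 0)) \<le> 2 * l n)}" for n
  have "\<exists>T\<in>sets lborel. sh n \<subseteq> T \<and>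
      emeasure lborel T \<le> ennreal (4 * (2 * l n)) * hausdorff3_outer (F n)" for n
    unfolding sh_def by (rule ray_shadow_slab[OF ab]) (simp add: l0)
  then obtain T where T: "\<And>n. T n \<in> sets lborel" "\<And>n. sh n \<subseteq> T n"
    "\<And>n. emeasure lborel (T n) \<le> ennreal (4 * (2 * l n)) * hausdorff3_outer (F n)" by metis
  \<comment> \<open>Tilt does not decrease along a ray, so a point hit from the positive side has
    positive tilt and belongs to some \<open>F n\<close>.\<close>
  have g_ray: "?g q \<le> ?g (q \<odot> (\<tau> * a, \<tau> * b, 0))" if "0 \<le> \<tau>" for q \<tau>
  proof -
    have "?g (q \<odot> (\<tau> * a, \<tau> * b, 0)) = ?g q + \<tau> * (a\<^sup>2 + b\<^sup>2)"
      by (cases q) (simp add: tilt_def power2_eq_square algebra_simps)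
    then show ?thesis using that by (simp add: ab)
  qed
  have sub: "{q. 0 < ?g q \<and> (\<exists>\<tau>\<ge>0. q \<odot> (\<tau> * a, \<tau> * b, 0) \<in> E)} \<subseteq> (\<Union>n. T n)"
  proof clarify
    fix q \<tau> assume q: "0 < ?g q" "0 \<le> (\<tau>::real)" "q \<odot> (\<tau> * a, \<tau> * b, 0) \<in> E"
    have "0 < ?g (q \<odot> (\<tau> * a, \<tau> * b, 0))" using q g_ray[of \<tau> q] by linarith
    then obtain n where n: "q \<odot> (\<tau> * a, \<tau> * b, 0) \<in> F n" using UN[OF q(3)] by blast
    then have "?g (q \<odot> (\<tau> * a, \<tau> * b, 0)) \<le> 2 * l n" by (auto simp: F_def)
    then show "q \<in> (\<Union>n. T n)" using q n T(2)[of n] by (auto simp: sh_def)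
  qed
  have part: "ennreal (l n) * hausdorff3_outer (F n) \<le> (\<integral>\<^sup>+x. ennreal (?g x) * indicator (F n) x \<partial>hausdorff3)" for n
  proof -
    have "ennreal (l n) * hausdorff3_outer (F n) = (\<integral>\<^sup>+x. ennreal (l n) * indicator (F n) x \<partial>hausdorff3)"
      using F by (simp add: nn_integral_cmult_indicator emeasure_hausdorff3)
    also have "\<dots> \<le> (\<integral>\<^sup>+x. ennreal (?g x) * indicator (F n) x \<partial>hausdorff3)"
      by (intro nn_integral_mono) (auto simp: F_def indicator_def intro: ennreal_leI)
    finally show ?thesis .
  qed
  have "emeasure lborel (\<Union>n. T n) \<le> (\<Sum>n. emeasure lborel (T n))"
    using T(1) by (intro emeasure_subadditive_countably) auto
  also have "\<dots> \<le> (\<Sum>n. 8 * (\<integral>\<^sup>+x. ennreal (?g x) * indicator (F n) x \<partial>hausdorff3))"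
  proof (intro suminf_le)
    fix n
    have "ennreal (4 * (2 * l n)) = 8 * ennreal (l n)"
      using l0[of n] by (simp add: ennreal_mult')
    then show "emeasure lborel (T n) \<le> 8 * (\<integral>\<^sup>+x. ennreal (?g x) * indicator (F n) x \<partial>hausdorff3)"
      using T(3)[of n] mult_left_mono[OF part[of n], of 8] by (simp add: mult.assoc)
  qed auto
  also have "\<dots> = 8 * (\<Sum>n. \<integral>\<^sup>+x. ennreal (?g x) * indicator (F n) x \<partial>hausdorff3)" by simp
  also have "(\<Sum>n. \<integral>\<^sup>+x. ennreal (?g x) * indicator (F n) x \<partial>hausdorff3)
      = (\<integral>\<^sup>+x. (\<Sum>n. ennreal (?g x) * indicator (F n) x) \<partial>hausdorff3)"
    by (intro nn_integral_suminf[symmetric]) measurable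
  also have "\<dots> = (\<integral>\<^sup>+x. ennreal (?g x) * indicator (\<Union>n. F n) x \<partial>hausdorff3)"
    by (intro nn_integral_cong) (simp add: suminf_indicator[OF disj])
  also have "8 * (\<integral>\<^sup>+x. ennreal (?g x) * indicator (\<Union>n. F n) x \<partial>hausdorff3)
      \<le> 8 * (\<integral>\<^sup>+x\<in>E. ennreal (?g x) \<partial>hausdorff3)"
    by (intro mult_left_mono nn_integral_mono) (auto simp: F_def indicator_def)
  finally show ?thesis
    using sub T(1) by (intro bexI[of _ "\<Union>n. T n"]) auto
qed

section \<open>Vertical perimeter and distance to a vertical plane\<close>

lemma heis_dist_mult_right: "heis_dist q (q \<odot> w) = heis_norm w"
proof -
  have "heis_inv (q \<odot> w) \<odot> q = heis_inv w" by (metis heis_group heis_inv_mult)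
  then show ?thesis by (simp add: heis_dist_def heis_norm_inv)
qed

lemma heis_dist_mult_le: "heis_dist p (q \<odot> w) \<le> heis_dist p q + heis_norm w"
  using heis_dist_triangle[of p "q \<odot> w" q] by (simp add: heis_dist_mult_right)

lemma open_heis_ball: "open (heis_ball p r)"
  unfolding heis_ball_def by (intro open_Collect_less continuous_heis_dist continuous_intros)

lemma heis_norm_horizontal: "a\<^sup>2 + b\<^sup>2 = 1 \<Longrightarrow> heis_norm (\<tau> * a, \<tau> * b, 0) = \<bar>\<tau>\<bar>"
proof -
  assume ab: "a\<^sup>2 + b\<^sup>2 = 1"
  have "norm (\<tau> * a, \<tau> * b) = sqrt (\<tau>\<^sup>2 * (a\<^sup>2 + b\<^sup>2))"
    by (simp add: norm_Pair power_mult_distrib distrib_left)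
  then show ?thesis by (simp add: ab)
qed

text \<open>Dropping the \<open>t\<close> coordinate does not increase distances; then
  Cauchy-Schwarz against the unit vector \<open>(a, b)\<close>.\<close>

lemma tilt_lipschitz:
  assumes ab: "a\<^sup>2 + b\<^sup>2 = 1"
  shows "\<bar>tilt a b c x - tilt a b c y\<bar> \<le> heis_dist x y"
proof -
  obtain x1 x2 x3 y1 y2 y3 where xy: "x = (x1, x2, x3)" "y = (y1, y2, y3)" by (metis prod_cases3)
  have "\<bar>(a, b) \<bullet> (x1 - y1, x2 - y2)\<bar> \<le> norm (a, b) * norm (x1 - y1, x2 - y2)"
    by (rule Cauchy_Schwarz_ineq2)
  also have "norm (a, b) = 1" by (simp add: norm_Pair ab)
  also have "1 * norm (x1 - y1, x2 - y2) \<le> heis_dist x y"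
    by (simp add: heis_dist_def xy)
  finally show ?thesis by (simp add: tilt_def xy algebra_simps)
qed

lemma tilt_mult: "tilt a b c (q \<odot> w) = tilt a b c q + a * fst w + b * fst (snd w)"
  by (cases q; cases w) (simp add: tilt_def algebra_simps)

lemma tilt_ray:
  assumes "a\<^sup>2 + b\<^sup>2 = 1"
  shows "tilt a b c (q \<odot> (\<tau> * a, \<tau> * b, 0)) = tilt a b c q + \<tau>"
proof -
  have "a * (\<tau> * a) + b * (\<tau> * b) = \<tau> * (a\<^sup>2 + b\<^sup>2)" by (simp add: power2_eq_square algebra_simps)
  then show ?thesis using assms by (simp add: tilt_mult add.assoc)
qed

text \<open>A normal vector of \<open>W\<close> is orthogonal to the \<open>t\<close>-axis, so its
  last coordinate vanishes and its horizontal part can be normalised.\<close>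

lemma vertical_subgroup_normal:
  assumes "vertical_subgroup W"
  obtains a b where "a\<^sup>2 + b\<^sup>2 = 1" "\<And>w. w \<in> W \<Longrightarrow> a * fst w + b * fst (snd w) = 0"
proof -
  have W: "subspace W" "dim W = 2" "\<And>t. (0, 0, t) \<in> W" using assms by (auto simp: vertical_subgroup_def)
  have "dim W < DIM(heis)" using W by simp
  then obtain n :: heis where n: "n \<noteq> 0" "\<And>w. w \<in> span W \<Longrightarrow> orthogonal n w"
    using orthogonal_to_subspace_exists by metis
  obtain a b e where abe: "n = (a, b, e)" by (metis prod_cases3)
  have "orthogonal n (0, 0, 1)" using n(2) W(3) span_base by blast
  then have "e = 0" by (simp add: orthogonal_def abe)
  then have "(a, b) \<noteq> 0" using n(1) abe by (auto simp: zero_prod_def)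
  define k where "k = norm (a, b)"
  have k: "0 < k" "k\<^sup>2 = a\<^sup>2 + b\<^sup>2"
    using \<open>(a, b) \<noteq> 0\<close> unfolding k_def zero_less_norm_iff by (auto simp: norm_Pair)
  show ?thesis
  proof
    show "(a / k)\<^sup>2 + (b / k)\<^sup>2 = 1"
      using k(1) by (simp add: power_divide add_divide_distrib[symmetric] k(2)[symmetric])
    fix w assume "w \<in> W"
    then have "orthogonal n w" using n(2) span_base by blast
    then have "a * fst w + b * fst (snd w) = 0"
      by (cases w) (simp add: orthogonal_def abe \<open>e = 0\<close>)
    then show "a / k * fst w + b / k * fst (snd w) = 0"
      by (simp add: add_divide_distrib[symmetric])
  qed
qed

text \<open>For this constant the tilt vanishes on the translated plane, and it is
  1-Lipschitz.\<close>

lemma tilt_le_heis_setdist: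
  assumes ab: "a\<^sup>2 + b\<^sup>2 = 1" and W: "\<And>w. w \<in> W \<Longrightarrow> a * fst w + b * fst (snd w) = 0"
  shows "ennreal \<bar>tilt a b (a * fst z + b * fst (snd z)) x\<bar> \<le> heis_setdist x ((\<lambda>w. z \<odot> w) ` W)"
  unfolding heis_setdist_def
proof (rule INF_greatest)
  fix y assume "y \<in> (\<lambda>w. z \<odot> w) ` W"
  then obtain w where y: "y = z \<odot> w" "w \<in> W" by blast
  then have "tilt a b (a * fst z + b * fst (snd z)) (z \<odot> w) = 0"
    using W[of w] tilt_mult[of a b "a * fst z + b * fst (snd z)" z w] by (simp add: tilt_def)
  then show "ennreal \<bar>tilt a b (a * fst z + b * fst (snd z)) x\<bar> \<le> ennreal (heis_dist x y)"
    unfolding y(1) using tilt_lipschitz[OF ab, of "a * fst z + b * fst (snd z)" x "z \<odot> w"] by (intro ennreal_leI) simp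
qed

text \<open>The ball lies in an unrotated sheared box with sides \<open>2 r\<close>,
  \<open>2 r\<close> and \<open>r^2 / 2\<close>.\<close>

lemma emeasure_heis_ball_le:
  assumes "0 < r"
  shows "emeasure lborel (heis_ball p r) \<le> ennreal (2 * r ^ 4)"
proof -
  obtain x0 y0 t0 where p: "p = (x0, y0, t0)" by (metis prod_cases3)
  \<comment> \<open>The height over \<open>(x, y)\<close> of the horizontal plane through
    \<open>p\<close>.\<close>
  define \<phi> where "\<phi> = (\<lambda>x y. t0 + (x0 * y - x * y0) / 2)"
  have \<phi>: "case_prod \<phi> \<in> borel_measurable borel"
    unfolding \<phi>_def case_prod_beta'
    by (rule borel_measurable_continuous_onI) (auto intro!: continuous_intros)
  have "heis_ball p r \<subseteq> sheared_box 1 0 (x0 - r) (2 * r) y0 r (r\<^sup>2 / 4) \<phi>"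
  proof
    fix q assume q: "q \<in> heis_ball p r"
    obtain x y t where q': "q = (x, y, t)" by (metis prod_cases3)
    define m where "m = t0 - t + (x0 * y - x * y0) / 2"
    have "heis_inv q \<odot> p = (x0 - x, y0 - y, m)" by (simp add: q' p m_def field_simps)
    then have n: "norm (x0 - x, y0 - y) < r" "2 * sqrt \<bar>m\<bar> < r"
      using q by (auto simp: heis_ball_def heis_dist_def)
    have "4 * \<bar>m\<bar> \<le> r\<^sup>2"
      using power_mono[of "2 * sqrt \<bar>m\<bar>" r 2] n(2) by (simp add: power_mult_distrib)
    moreover have "\<bar>x0 - x\<bar> < r" "\<bar>y0 - y\<bar> < r"
      using n(1) norm_fst_le[of "x0 - x" "y0 - y"] norm_snd_le[of "y0 - y" "x0 - x"] by auto
    moreover have "t - \<phi> x y = - m" by (simp add: \<phi>_def m_def)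
    ultimately show "q \<in> sheared_box 1 0 (x0 - r) (2 * r) y0 r (r\<^sup>2 / 4) \<phi>"
      unfolding q' sheared_box_def by auto
  qed
  then have "emeasure lborel (heis_ball p r) \<le> emeasure lborel (sheared_box 1 0 (x0 - r) (2 * r) y0 r (r\<^sup>2 / 4) \<phi>)"
    using assms by (intro emeasure_mono) (auto intro!: sets_sheared_box \<phi>)
  also have "\<dots> = ennreal (2 * r * (2 * r) * (2 * (r\<^sup>2 / 4)))"
    using assms by (intro emeasure_sheared_box \<phi>) auto
  also have "2 * r * (2 * r) * (2 * (r\<^sup>2 / 4)) = 2 * r ^ 4"
    by (simp add: power2_eq_square power4_eq_xxxx)
  finally show ?thesis .
qed

section \<open>Paths crossing the boundary\<close>

lemma path_meets_frontier:
  fixes \<gamma> :: "real \<Rightarrow> 'a::topological_space"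
  assumes "continuous_on {0..l} \<gamma>" "0 \<le> l" "(\<gamma> 0 \<in> S) \<noteq> (\<gamma> l \<in> S)"
  shows "\<exists>t\<in>{0..l}. \<gamma> t \<in> frontier S"
proof -
  have "connected (\<gamma> ` {0..l})" using assms by (intro connected_continuous_image) auto
  moreover have "\<gamma> ` {0..l} \<inter> S \<noteq> {}" "\<gamma> ` {0..l} - S \<noteq> {}" using assms(2,3) by force+
  ultimately show ?thesis using connected_Int_frontier by blast
qed

lemma ray_meets_frontier:
  assumes "0 \<le> l" "(q \<in> S) \<noteq> (q \<odot> (l * a, l * b, 0) \<in> S)"
  shows "\<exists>\<tau>\<in>{0..l}. q \<odot> (\<tau> * a, \<tau> * b, 0) \<in> frontier S"
proof (rule path_meets_frontier)
  obtain x y t where q: "q = (x, y, t)" by (metis prod_cases3)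
  show "continuous_on {0..l} (\<lambda>\<tau>. q \<odot> (\<tau> * a, \<tau> * b, 0))"
    unfolding q heis_mult.simps by (intro continuous_intros) auto
qed (use assms heis_group(3)[of q] in \<open>auto simp: zero_prod_def\<close>)

lemma vertical_meets_frontier:
  assumes "0 \<le> l" "(q \<in> S) \<noteq> (q \<odot> (0, 0, l) \<in> S)"
  shows "\<exists>\<tau>\<in>{0..l}. q \<odot> (0, 0, \<tau>) \<in> frontier S"
proof (rule path_meets_frontier)
  obtain x y t where q: "q = (x, y, t)" by (metis prod_cases3)
  show "continuous_on {0..l} (\<lambda>\<tau>. q \<odot> (0, 0, \<tau>))"
    unfolding q heis_mult.simps by (intro continuous_intros) auto
qed (use assms heis_group(3)[of q] in \<open>auto simp: zero_prod_def\<close>)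

text \<open>The path from \<open>q\<close> to \<open>q \<odot> (0, 0, s\<^sup>2)\<close> consists of a horizontal ray leaving the plane
  \<open>tilt = 0\<close>, a vertical segment, and the vertical translate of the ray. If the frontier has
  diameter less than \<open>24 r\<close>, the rays are taken so long that the segment misses it.\<close>

lemma ray_hit_or_far_point:
  assumes ab: "a\<^sup>2 + b\<^sup>2 = 1" and s: "0 < s" "s \<le> r" and p: "p \<in> frontier \<Omega>"
    and q: "q \<in> heis_ball p r" "0 < tilt a b c q" "(q \<in> \<Omega>) \<noteq> (q \<odot> (0, 0, s\<^sup>2) \<in> \<Omega>)"
  defines "K \<equiv> heis_ball p (24 * r) \<inter> frontier \<Omega>"
  shows "(\<exists>\<tau>\<ge>0. q \<odot> (\<tau> * a, \<tau> * b, 0) \<in> K) \<or> (\<exists>\<tau>\<ge>0. q \<odot> (0, 0, s\<^sup>2) \<odot> (\<tau> * a, \<tau> * b, 0) \<in> K) \<or>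
    ennreal (24 * r) \<le> heis_diam (frontier \<Omega>) \<and> (\<exists>e\<in>frontier \<Omega>. r \<le> tilt a b c e \<and> heis_dist p e < 4 * r)"
proof -
  let ?E = "frontier \<Omega>" and ?h = "\<lambda>\<tau>. (\<tau> * a, \<tau> * b, 0 :: real)" and ?\<sigma> = "(0, 0, s\<^sup>2) :: heis"
  \<comment> \<open>Vertical elements are central, so both rays end on a common vertical
    segment.\<close>
  have central: "q \<odot> ?\<sigma> \<odot> ?h \<tau> = q \<odot> ?h \<tau> \<odot> ?\<sigma>" for \<tau>
    by (cases q) (simp add: algebra_simps)
  have trichotomy: "(\<exists>\<tau>\<in>{0..l}. q \<odot> ?h \<tau> \<in> ?E) \<or> (\<exists>\<tau>\<in>{0..l}. q \<odot> ?\<sigma> \<odot> ?h \<tau> \<in> ?E) \<or>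
      (\<exists>\<tau>\<in>{0..s\<^sup>2}. q \<odot> ?h l \<odot> (0, 0, \<tau>) \<in> ?E)" if "0 \<le> l" for l
  proof (rule ccontr)
    assume no: "\<not> ?thesis"
    have "(q \<in> \<Omega>) = (q \<odot> ?h l \<in> \<Omega>)"
      using ray_meets_frontier[OF that, of q \<Omega> a b] no by blast
    also have "\<dots> = (q \<odot> ?h l \<odot> ?\<sigma> \<in> \<Omega>)"
      using vertical_meets_frontier[of "s\<^sup>2" "q \<odot> ?h l" \<Omega>] no zero_le_power2[of s] by blast
    also have "\<dots> = (q \<odot> ?\<sigma> \<in> \<Omega>)"
      using ray_meets_frontier[OF that, of "q \<odot> ?\<sigma>" \<Omega> a b] no unfolding central[of l] by blast
    finally show False using q(3) by blast
  qed
  have tilt_far: "tilt a b c (q \<odot> ?h l \<odot> (0, 0, \<tau>)) = tilt a b c q + l" for l \<tau>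
    using tilt_ray[OF ab, of c q l] by (simp add: tilt_mult)
  \<comment> \<open>Height at most \<open>s^2\<close> costs distance at most \<open>2 * s\<close>,
    by the factor 2 in the norm.\<close>
  have nv: "heis_norm (0, 0, \<tau>) \<le> 2 * s" if "\<tau> \<in> {0..s\<^sup>2}" for \<tau>
  proof -
    have "sqrt \<tau> \<le> s" using that s by (intro real_le_lsqrt) auto
    then show ?thesis using that s by (simp add: norm_Pair)
  qed
  show ?thesis
  proof (cases "ennreal (24 * r) \<le> heis_diam ?E")
    case True
    \<comment> \<open>With rays of length \<open>r\<close> the whole path stays within
      \<open>r + r + 2 s \<le> 4 r\<close> of \<open>p\<close>, well inside the ball of radius
      \<open>24 * r\<close>.\<close>
    have "q \<odot> ?h \<tau> \<in> K" if "\<tau> \<in> {0..r}" "q \<odot> ?h \<tau> \<in> ?E" for \<tau>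
      using heis_dist_mult_le[of p q "?h \<tau>"] heis_norm_horizontal[OF ab, of \<tau>] that q(1) s
      by (auto simp: K_def heis_ball_def)
    moreover have "q \<odot> ?\<sigma> \<odot> ?h \<tau> \<in> K" if "\<tau> \<in> {0..r}" "q \<odot> ?\<sigma> \<odot> ?h \<tau> \<in> ?E" for \<tau>
      using heis_dist_mult_le[of p "q \<odot> ?\<sigma>" "?h \<tau>"] heis_dist_mult_le[of p q ?\<sigma>] nv[of "s\<^sup>2"]
        heis_norm_horizontal[OF ab, of \<tau>] that q(1) s
      by (auto simp: K_def heis_ball_def simp del: heis_norm.simps)
    moreover have "r \<le> tilt a b c (q \<odot> ?h r \<odot> (0, 0, \<tau>)) \<and> heis_dist p (q \<odot> ?h r \<odot> (0, 0, \<tau>)) < 4 * r"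
      if "\<tau> \<in> {0..s\<^sup>2}" for \<tau>
      using heis_dist_mult_le[of p "q \<odot> ?h r" "(0, 0, \<tau>)"] heis_dist_mult_le[of p q "?h r"] nv[OF that]
        heis_norm_horizontal[OF ab, of r] q(1,2) s tilt_far[of r \<tau>]
      by (simp add: heis_ball_def del: heis_norm.simps)
    moreover have "0 \<le> r" using s by simp
    ultimately show ?thesis using trichotomy[of r] True by (meson atLeastAtMost_iff)
  next
    case False
    have E: "heis_dist p e < 24 * r" if "e \<in> ?E" for e
    proof -
      have "ennreal (heis_dist p e) < ennreal (24 * r)"
        using heis_diam_upper[OF p that] False by (meson le_less_trans not_le)
      then show ?thesis by (simp add: ennreal_less_iff)
    qed
    then have EK: "e \<in> K" if "e \<in> ?E" for e using that by (simp add: K_def heis_ball_def)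
    \<comment> \<open>The tilt on the vertical segment exceeds \<open>l\<close>, whereas points
      within \<open>24 * r\<close> of \<open>p\<close>, and so all frontier points, have tilt below
      \<open>l\<close>.\<close>
    define l where "l = \<bar>tilt a b c p\<bar> + 24 * r"
    have "q \<odot> ?h l \<odot> (0, 0, \<tau>) \<notin> ?E" for \<tau>
    proof
      assume e: "q \<odot> ?h l \<odot> (0, 0, \<tau>) \<in> ?E"
      show False
        using E[OF e] tilt_lipschitz[OF ab, of c p "q \<odot> ?h l \<odot> (0, 0, \<tau>)"] tilt_far[of l \<tau>] q(2)
        unfolding l_def by linarith
    qed
    moreover have "0 \<le> l" using s by (simp add: l_def)
    ultimately show ?thesis
      using trichotomy[of l] EK by (meson atLeastAtMost_iff)
  qed
qed

section \<open>The vertical perimeter bounded by the integral of the tilt\<close>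

lemma emeasure_lborel_plus_vimage:
  fixes v :: "'a::euclidean_space"
  assumes "T \<in> sets borel"
  shows "(+) v -` T \<in> sets borel" "emeasure lborel ((+) v -` T) = emeasure lborel T"
proof -
  have m: "(+) v \<in> borel_measurable borel" by measurable
  show "(+) v -` T \<in> sets borel" using measurable_sets[OF m assms] by simp
  show "emeasure lborel ((+) v -` T) = emeasure lborel T"
    by (subst (2) lborel_distr_plus[of v, symmetric]) (use assms in \<open>simp add: emeasure_distr\<close>)
qed

lemma vertical_perimeter_le_emeasure:
  assumes "Z \<in> sets lebesgue" "\<And>q. q \<in> U \<Longrightarrow> (q \<in> \<Omega>) \<noteq> (q \<odot> (0, 0, s\<^sup>2) \<in> \<Omega>) \<Longrightarrow> q \<in> Z"
  shows "vertical_perimeter \<Omega> U s \<le> emeasure lebesgue Z"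
proof -
  have "vertical_perimeter \<Omega> U s \<le> (\<integral>\<^sup>+q. indicator Z q \<partial>lebesgue)"
    unfolding vertical_perimeter_def
    by (intro nn_integral_mono) (use assms(2) in \<open>auto simp: indicator_def\<close>)
  then show ?thesis using assms(1) by simp
qed

text \<open>If some frontier point near \<open>p\<close> is far from the plane, regularity makes the
  integral at least a multiple of \<open>r^4\<close>, which beats the volume of the ball. Otherwise
  the separated points lie, up to a null set, in four shadow sets, each of measure at most 8 times
  the integral.\<close>

lemma vertical_perimeter_le_integral:
  assumes reg: "regular3 A (frontier \<Omega>)" and p: "p \<in> frontier \<Omega>" and s: "0 < s" "s \<le> r"
    and ab: "a\<^sup>2 + b\<^sup>2 = 1"
  shows "vertical_perimeter \<Omega> (heis_ball p r) s \<le> ennreal (32 * A) *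
    (\<integral>\<^sup>+x\<in>heis_ball p (24 * r) \<inter> frontier \<Omega>. ennreal \<bar>tilt a b c x\<bar> \<partial>hausdorff3)"
    (is "_ \<le> _ * ?I")
proof -
  define E where "E = frontier \<Omega>"
  define K where "K = heis_ball p (24 * r) \<inter> E"
  have A: "1 \<le> A" using reg by (simp add: regular3_def)
  have r: "0 < r" using s by simp
  have K: "K \<in> sets hausdorff3"
  proof -
    have "K \<in> sets borel"
      unfolding K_def E_def by (intro sets.Int borel_open open_heis_ball borel_closed frontier_closed)
    then show ?thesis using borel_subset_hausdorff3 by blast
  qed
  show ?thesis
  proof (cases "ennreal (24 * r) \<le> heis_diam E \<and> (\<exists>e\<in>E. r \<le> \<bar>tilt a b c e\<bar> \<and> heis_dist p e < 4 * r)")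
    case True
    then obtain e where e: "e \<in> E" "r \<le> \<bar>tilt a b c e\<bar>" "heis_dist p e < 4 * r"
      and diam: "ennreal (24 * r) \<le> heis_diam E" by blast
    \<comment> \<open>On this half-size ball the tilt is still at least \<open>r / 2\<close> in
      absolute value, and \<open>4 r + r / 2 < 24 r\<close> keeps it inside the domain of
      integration.\<close>
    define D where "D = E \<inter> heis_ball e (r / 2)"
    have "D \<in> sets borel"
      unfolding D_def E_def by (intro sets.Int borel_open open_heis_ball borel_closed frontier_closed)
    then have D: "D \<in> sets hausdorff3" using borel_subset_hausdorff3 by blast
    have "ennreal (r / 2) \<le> heis_diam E"
      using r by (intro order_trans[OF _ diam] ennreal_leI) auto
    then have "ennreal (inverse A * (r / 2) ^ 3) \<le> emeasure hausdorff3 D"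
      using reg e(1) r unfolding regular3_def D_def E_def by auto
    then have "ennreal (r / 2) * ennreal (inverse A * (r / 2) ^ 3) \<le> ennreal (r / 2) * emeasure hausdorff3 D"
      by (rule mult_left_mono) simp
    also have "\<dots> = (\<integral>\<^sup>+x. ennreal (r / 2) * indicator D x \<partial>hausdorff3)"
      using D by (simp add: nn_integral_cmult_indicator)
    also have "\<dots> \<le> ?I"
    proof (rule nn_integral_mono)
      fix x
      show "ennreal (r / 2) * indicator D x \<le> ennreal \<bar>tilt a b c x\<bar> * indicator (heis_ball p (24 * r) \<inter> frontier \<Omega>) x"
      proof (cases "x \<in> D")
        case True
        then have x: "heis_dist e x < r / 2" "x \<in> E" by (auto simp: D_def heis_ball_def)
        have "heis_dist p x < 24 * r" using heis_dist_triangle[of p x e] x(1) e(3) r by linarith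
        then have "x \<in> heis_ball p (24 * r) \<inter> frontier \<Omega>" using x(2) by (simp add: heis_ball_def E_def)
        moreover have "r / 2 \<le> \<bar>tilt a b c x\<bar>"
          using tilt_lipschitz[OF ab, of c e x] x(1) e(2) by linarith
        then have "ennreal (r / 2) \<le> ennreal \<bar>tilt a b c x\<bar>" by (rule ennreal_leI)
        ultimately show ?thesis using True by simp
      qed simp
    qed
    finally have "ennreal (32 * A) * (ennreal (r / 2) * ennreal (inverse A * (r / 2) ^ 3)) \<le> ennreal (32 * A) * ?I"
      by (rule mult_left_mono) simp
    \<comment> \<open>The constant 32 is just enough to reach the volume bound:
      \<open>32 A * (r / 2) * r^3 / (8 A) = 2 r^4\<close>.\<close>
    moreover have "ennreal (32 * A) * (ennreal (r / 2) * ennreal (inverse A * (r / 2) ^ 3)) = ennreal (2 * r ^ 4)"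
      using r A by (simp add: ennreal_mult[symmetric] field_simps power3_eq_cube power4_eq_xxxx)
    ultimately have lower: "ennreal (2 * r ^ 4) \<le> ennreal (32 * A) * ?I" by simp
    have "vertical_perimeter \<Omega> (heis_ball p r) s \<le> emeasure lebesgue (heis_ball p r)"
    proof (rule vertical_perimeter_le_emeasure)
      show "heis_ball p r \<in> sets lebesgue"
        using borel_open[OF open_heis_ball, of p r] by (intro sets_completionI_sets) simp
    qed
    also have "\<dots> \<le> ennreal (2 * r ^ 4)"
      using emeasure_heis_ball_le[OF r, of p] open_heis_ball by simp
    also note lower
    finally show ?thesis .
  next
    case nofar: False
    \<comment> \<open>Reversing the normal handles the points on the other side of the
      plane.\<close>
    have neg: "(- a)\<^sup>2 + (- b)\<^sup>2 = 1" using ab by simp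
    have tneg: "tilt (- a) (- b) (- c) x = - tilt a b c x" for x by (simp add: tilt_def)
    obtain T where T: "T \<in> sets lborel"
      "{q. 0 < tilt a b c q \<and> (\<exists>\<tau>\<ge>0. q \<odot> (\<tau> * a, \<tau> * b, 0) \<in> K)} \<subseteq> T"
      "emeasure lborel T \<le> 8 * (\<integral>\<^sup>+x\<in>K. ennreal (tilt a b c x) \<partial>hausdorff3)"
      using ray_shadow[OF ab K] by blast
    obtain T' where T': "T' \<in> sets lborel"
      "{q. 0 < tilt (- a) (- b) (- c) q \<and> (\<exists>\<tau>\<ge>0. q \<odot> (\<tau> * - a, \<tau> * - b, 0) \<in> K)} \<subseteq> T'"
      "emeasure lborel T' \<le> 8 * (\<integral>\<^sup>+x\<in>K. ennreal (tilt (- a) (- b) (- c) x) \<partial>hausdorff3)"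
      using ray_shadow[OF neg K] by blast
    have I: "(\<integral>\<^sup>+x\<in>K. ennreal (f x) \<partial>hausdorff3) \<le> ?I" if "\<And>x. f x \<le> \<bar>tilt a b c x\<bar>" for f
      unfolding K_def E_def
      by (intro nn_integral_mono mult_right_mono ennreal_leI that) simp
    have T8: "emeasure lborel T \<le> 8 * ?I" "emeasure lborel T' \<le> 8 * ?I"
      using order_trans[OF T(3) mult_left_mono[OF I]] order_trans[OF T'(3) mult_left_mono[OF I]]
      by (auto simp: tneg)
    \<comment> \<open>Points on the plane itself have no outward side; they form a null set.\<close>
    define N where "N = {q. tilt a b c q = 0}"
    have N: "N \<in> null_sets lebesgue"
    proof -
      have "N = {q. (a, b, 0) \<bullet> q = c}" by (auto simp: N_def tilt_def inner_prod_def)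
      moreover have "(a, b, 0 :: real) \<noteq> 0" using ab by (auto simp: zero_prod_def)
      ultimately show ?thesis
        using negligible_hyperplane[of "(a, b, 0 :: real)" c] by (simp add: negligible_iff_null_sets)
    qed
    let ?\<sigma> = "(0, 0, s\<^sup>2) :: heis"
    \<comment> \<open>A vertical shift is a Euclidean translation, so it preserves Lebesgue
      measure.\<close>
    have \<sigma>: "q \<odot> ?\<sigma> = ?\<sigma> + q" for q by (cases q) simp
    \<comment> \<open>The preimages catch those \<open>q\<close> for which the ray from the shifted
      point is the one that hits \<open>K\<close>.\<close>
    define V where "V = T \<union> T' \<union> ((+) ?\<sigma> -` T \<union> (+) ?\<sigma> -` T')"
    have Vb: "T \<in> sets borel" "T' \<in> sets borel" using T(1) T'(1) by auto
    note sh = emeasure_lborel_plus_vimage[OF Vb(1), of ?\<sigma>] emeasure_lborel_plus_vimage[OF Vb(2), of ?\<sigma>]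
    have VB: "V \<in> sets borel" unfolding V_def using Vb sh by auto
    have "emeasure lborel V \<le> (emeasure lborel T + emeasure lborel T') + (emeasure lborel T + emeasure lborel T')"
      unfolding V_def using Vb sh
      by (intro order_trans[OF emeasure_subadditive] add_mono) (auto intro!: order_trans[OF emeasure_subadditive])
    also have "\<dots> \<le> (8 * ?I + 8 * ?I) + (8 * ?I + 8 * ?I)" by (intro add_mono T8)
    also have "\<dots> = ennreal 32 * ?I" by (simp add: distrib_right[symmetric])
    also have "\<dots> \<le> ennreal (32 * A) * ?I" using A by (intro mult_right_mono ennreal_leI) auto
    finally have V: "emeasure lborel V \<le> ennreal (32 * A) * ?I" .
    have "vertical_perimeter \<Omega> (heis_ball p r) s \<le> emeasure lebesgue (V \<union> N)"
    proof (rule vertical_perimeter_le_emeasure)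
      show "V \<union> N \<in> sets lebesgue" using VB N by auto
      fix q assume q: "q \<in> heis_ball p r" "(q \<in> \<Omega>) \<noteq> (q \<odot> ?\<sigma> \<in> \<Omega>)"
      have t\<sigma>: "tilt a b c (q \<odot> ?\<sigma>) = tilt a b c q" by (simp add: tilt_mult)
      consider "tilt a b c q = 0" | "0 < tilt a b c q" | "0 < tilt (- a) (- b) (- c) q"
        unfolding tneg by linarith
      then show "q \<in> V \<union> N"
      proof cases
        case 1
        then show ?thesis by (simp add: N_def)
      next
        case 2
        have "(\<exists>\<tau>\<ge>0. q \<odot> (\<tau> * a, \<tau> * b, 0) \<in> K) \<or> (\<exists>\<tau>\<ge>0. q \<odot> ?\<sigma> \<odot> (\<tau> * a, \<tau> * b, 0) \<in> K)"
          using ray_hit_or_far_point[OF ab s p q(1) 2 q(2)] nofar unfolding K_def E_def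
          by (meson abs_ge_self order_trans)
        then have "q \<in> T \<or> q \<odot> ?\<sigma> \<in> T" using T(2) 2 t\<sigma> by (metis (mono_tags, lifting) mem_Collect_eq subsetD)
        then show ?thesis by (auto simp: V_def \<sigma>)
      next
        case 3
        have "(\<exists>\<tau>\<ge>0. q \<odot> (\<tau> * - a, \<tau> * - b, 0) \<in> K) \<or> (\<exists>\<tau>\<ge>0. q \<odot> ?\<sigma> \<odot> (\<tau> * - a, \<tau> * - b, 0) \<in> K)"
          using ray_hit_or_far_point[OF neg s p q(1) 3 q(2)] nofar unfolding K_def E_def tneg
          by (meson abs_ge_minus_self order_trans)
        moreover have "0 < tilt (- a) (- b) (- c) (q \<odot> ?\<sigma>)" using 3 by (simp only: tneg t\<sigma>)
        ultimately have "q \<in> T' \<or> q \<odot> ?\<sigma> \<in> T'" using T'(2) 3 by (metis (mono_tags, lifting) mem_Collect_eq subsetD)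
        then show ?thesis by (auto simp: V_def \<sigma>)
      qed
    qed
    also have "\<dots> = emeasure lborel V"
      using VB N by (simp add: emeasure_Un_null_set)
    finally show ?thesis using V by simp
  qed
qed

section \<open>Passage to the beta number\<close>

theorem corollary3p34:
  fixes A :: real
  assumes "A \<ge> 1"
  shows "\<exists>C::real. C > 0 \<and>
    (\<forall>\<Omega>. open \<Omega> \<and> regular3 A (frontier \<Omega>) \<longrightarrow>
      (\<forall>p\<in>frontier \<Omega>. \<forall>r s::real. 0 < s \<and> s \<le> r \<longrightarrow>
        vertical_perimeter \<Omega> (heis_ball p r) s / ennreal (r ^ 4)
          \<le> ennreal C * beta1 (frontier \<Omega>) p (24 * r)))"
proof (intro exI conjI allI impI ballI; (elim conjE)?)
  \<comment> \<open>\<open>32 * A\<close> comes from the tilt bound; \<open>24 ^ 4\<close> from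
    normalising beta by \<open>(24 r)^3\<close> and the distance by \<open>24 r\<close>.\<close>
  show "0 < 32 * A * 24 ^ 4" using assms by simp
  fix \<Omega> p and r s :: real
  assume reg: "regular3 A (frontier \<Omega>)" and p: "p \<in> frontier \<Omega>" and s: "0 < s" "s \<le> r"
  have r: "0 < r" using s by simp
  let ?C = "ennreal (32 * A * 24 ^ 4)" and ?v = "vertical_perimeter \<Omega> (heis_ball p r) s"
  \<comment> \<open>With the constant moved to the left, a bound for each single plane passes to the
    infimum.\<close>
  have "?v / ennreal (r ^ 4) / ?C \<le> beta1 (frontier \<Omega>) p (24 * r)"
    unfolding beta1_def
  proof (intro INF_greatest, clarify)
    fix W z assume W: "vertical_subgroup W"
    let ?d = "\<lambda>x. heis_setdist x ((\<lambda>w. z \<odot> w) ` W)" and ?K = "heis_ball p (24 * r) \<inter> frontier \<Omega>"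
    obtain a b where ab: "a\<^sup>2 + b\<^sup>2 = 1" and nW: "\<And>w. w \<in> W \<Longrightarrow> a * fst w + b * fst (snd w) = 0"
      using vertical_subgroup_normal[OF W] by blast
    \<comment> \<open>This level makes the tilt vanish on the translate of \<open>W\<close> by
      \<open>z\<close>.\<close>
    define c where "c = a * fst z + b * fst (snd z)"
    let ?I = "\<integral>\<^sup>+x\<in>?K. ennreal \<bar>tilt a b c x\<bar> \<partial>hausdorff3"
      and ?J = "\<integral>\<^sup>+x\<in>?K. ?d x / ennreal (24 * r) \<partial>hausdorff3"
    have div: "x / ennreal k = ennreal (1 / k) * x" if "0 < k" for x k
      using that by (simp add: divide_ennreal_def inverse_ennreal mult.commute inverse_eq_divide)
    have "(\<lambda>x. \<bar>tilt a b c x\<bar>) \<in> borel_measurable borel"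
      unfolding tilt_def by (intro borel_measurable_continuous_onI continuous_intros)
    then have meas: "(\<lambda>x. \<bar>tilt a b c x\<bar>) \<in> borel_measurable hausdorff3"
      using borel_subset_hausdorff3 by (auto simp: measurable_def)
    have "?K \<in> sets borel"
      by (intro sets.Int borel_open open_heis_ball borel_closed frontier_closed)
    then have "?K \<in> sets hausdorff3" using borel_subset_hausdorff3 by blast
    then have "ennreal (1 / (24 * r)) * ?I
        = (\<integral>\<^sup>+x\<in>?K. ennreal (1 / (24 * r)) * ennreal \<bar>tilt a b c x\<bar> \<partial>hausdorff3)"
      using meas by (subst nn_integral_cmult[symmetric]) (auto simp: mult.assoc)
    also have "\<dots> \<le> ?J"
      unfolding div[of "24 * r", OF mult_pos_pos[OF zero_less_numeral r]] c_def
      by (intro nn_integral_mono mult_right_mono mult_left_mono tilt_le_heis_setdist[OF ab nW]) auto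
    finally have J: "ennreal (1 / (24 * r)) * ?I \<le> ?J" .
    have "?v / ennreal (r ^ 4) / ?C = ennreal (1 / (32 * A * 24 ^ 4)) * (ennreal (1 / r ^ 4) * ?v)"
      using r assms by (simp add: div)
    also have "\<dots> \<le> ennreal (1 / (32 * A * 24 ^ 4)) * (ennreal (1 / r ^ 4) * (ennreal (32 * A) * ?I))"
      by (intro mult_left_mono vertical_perimeter_le_integral[OF reg p s ab]) auto
    also have "\<dots> = ennreal (1 / (24 * r) ^ 3) * (ennreal (1 / (24 * r)) * ?I)"
    proof -
      have "1 / (32 * A * 24 ^ 4) * (1 / r ^ 4 * (32 * A)) = 1 / (24 * r) ^ 3 * (1 / (24 * r))"
        using r assms by (simp add: field_simps power3_eq_cube power4_eq_xxxx)
      moreover have "ennreal (1 / (32 * A * 24 ^ 4)) * (ennreal (1 / r ^ 4) * ennreal (32 * A))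
          = ennreal (1 / (32 * A * 24 ^ 4) * (1 / r ^ 4 * (32 * A)))"
        using assms r by (subst (1 2) ennreal_mult) auto
      moreover have "ennreal (1 / (24 * r) ^ 3) * ennreal (1 / (24 * r)) = ennreal (1 / (24 * r) ^ 3 * (1 / (24 * r)))"
        using r by (intro ennreal_mult[symmetric]) auto
      ultimately have "ennreal (1 / (32 * A * 24 ^ 4)) * (ennreal (1 / r ^ 4) * ennreal (32 * A))
          = ennreal (1 / (24 * r) ^ 3) * ennreal (1 / (24 * r))" by metis
      then show ?thesis by (simp only: mult.assoc[symmetric])
    qed
    also have "\<dots> \<le> ennreal (1 / (24 * r) ^ 3) * ?J" by (intro mult_left_mono J) simp
    also have "\<dots> = ?J / ennreal ((24 * r) ^ 3)" using r by (simp add: div)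
    finally show "?v / ennreal (r ^ 4) / ?C \<le> ?J / ennreal ((24 * r) ^ 3)" .
  qed
  then show "?v / ennreal (r ^ 4) \<le> ?C * beta1 (frontier \<Omega>) p (24 * r)"
    using assms by (intro ennreal_divide_leD) auto
qed

end
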